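(* Let $(N,A_1,A_2,\dots)$ be as in the context and satisfy Conditions (C1) and (C8). Let $Z$ be an $\mathbb{R}_+^d$-valued solution of $Z\overset{\mathcal L}{=}\sum_{i=1}^NA_iZ_i$ with $\mathbb{P}[Z=0]=0$. Let $a>0$ be such that $\mathbb{E}[\|A_1\|^{-a}]<\infty$. Consider the statements (a) $\mathbb{E}[|Z|^{-a}]<\infty$; (b) $\tilde\kappa(-a)\,\mathbb{P}[N=1]<1$; (c) $\mathbb{E}[|Z|^{-b}]<\infty$ for all $b\in(0,a)$. Then: 1. If $\mathbb{P}[N=1]=0$, then (c) holds. 2. If $\mathbb{P}[N=1]>0$, then (a) $\Rightarrow$ (b) $\Rightarrow$ (c); if moreover $\mathbb{E}[\|A_1\|^{-a-\varepsilon}]<\infty$ for some $\varepsilon>0$, then (a) $\Leftrightarrow$ (b).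
   Context: Notation: $G$ is the set of $d\times d$ nonnegative matrices; $|x|=\sum_i|x_i|$; $\|a\|$ operator norm. Setting: random $A_i\in G$, $N=\#\{i:A_i\ne0\}<\infty$ a.s., $A_i\ne0$ iff $i\le N$; a solution is an $\mathbb{R}_+^d$-valued $Z$ with $Z\overset{\mathcal L}{=}\sum_{i=1}^NA_iZ_i$, $(Z_i)$ i.i.d. copies of $Z$ independent of $(N,A_1,\dots)$. (C1) $N\ge1$ a.s., $\mathbb{E}[N]\in(1,\infty)$, $A_i\in G$, $A_i\ne0$ iff $i\le N$. (C8) (Furstenberg–Kesten) There is $c>1$ with $0<\max_{i,j}A_1(i,j)\le c\min_{i,j}A_1(i,j)$ a.s., where $A_1(i,j)$ is the $(i,j)$ entry. When $\mathbb{P}[N=1]>0$, $\tilde A_1$ denotes a random matrix with the law of $A_1$ conditioned on $\{N=1\}$, $(\tilde A_i)_{i\ge2}$ are i.i.d. copies of it, $\tilde I_-=\{s\le0:\mathbb{E}[\|\tilde A_1\|^s]<\infty\}$, and for $s\in\tilde I_-$, $\tilde\kappa(s)=\lim_{n\to\infty}\mathbb{E}[\|\tilde A_n\cdots\tilde A_1\|^s]^{1/n}\in(0,\infty)$ (this limit exists under (C8)). *)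

theory Defs
  imports "HOL-Probability.Probability"
begin

type_synonym 'd mat = "real ^ 'd ^ 'd"

definition l1norm :: "real ^ ('d::finite) \<Rightarrow> real" where
  "l1norm x = (\<Sum>i\<in>UNIV. \<bar>x $ i\<bar>)"

definition opnorm :: "('d::finite) mat \<Rightarrow> real" where
  "opnorm a = (SUP x\<in>{x. l1norm x = 1}. l1norm (a *v x))"

definition nonneg_mat :: "('d::finite) mat \<Rightarrow> bool" where
  "nonneg_mat a \<longleftrightarrow> (\<forall>i j. 0 \<le> a $ i $ j)"

fun mprod :: "(nat \<Rightarrow> ('d::finite) mat) \<Rightarrow> nat \<Rightarrow> ('d::finite) mat" where
  "mprod f 0 = mat 1"
| "mprod f (Suc n) = f n ** mprod f n"

definition cond_law :: "'w measure \<Rightarrow> ('w \<Rightarrow> nat) \<Rightarrow> (nat \<Rightarrow> 'w \<Rightarrow> ('d::finite) mat) \<Rightarrow> ('d::finite) mat measure" where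
  "cond_law M N A =
     (let S = {\<omega>\<in>space M. N \<omega> = 1}
      in distr (density M (\<lambda>\<omega>. indicator S \<omega> / emeasure M S)) borel (A 1))"

definition kappa_tilde :: "'w measure \<Rightarrow> ('w \<Rightarrow> nat) \<Rightarrow> (nat \<Rightarrow> 'w \<Rightarrow> ('d::finite) mat) \<Rightarrow> real \<Rightarrow> real" where
  "kappa_tilde M N A s =
     lim (\<lambda>n. (\<integral>B. opnorm (mprod B n) powr s \<partial>(PiM {..<n} (\<lambda>_. cond_law M N A))) powr (1 / real n))"

end

theory Submission
  imports Defs
begin

text \<open>
  Write \<open>D f x = E f(x Z)\<close>. The fixed-point equation splits \<open>D f\<close> as \<open>T (D f) + R f\<close> according to
  whether \<open>N = 1\<close> or \<open>N \<ge> 2\<close>, so \<open>D f = T\<^sup>n (D f) + (\<Sum>k<n. T\<^sup>k (R f))\<close>, and everything is governed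
  by \<open>u n = P(N = 1)\<^sup>n E \<parallel>A\<^sub>n \<dots> A\<^sub>1\<parallel>\<^sup>-\<^sup>a\<close> (under the conditioned law). By (C8) \<open>u\<close> is multiplicative
  up to a constant factor; hence \<open>u n powr (1 / n)\<close> converges, and its limit
  \<open>\<kappa>(-a) P(N = 1)\<close> is less than 1 iff \<open>u\<close> tends to 0.

  If \<open>E |Z|\<^sup>-\<^sup>a\<close> is finite, then \<open>R f \<ge> J \<parallel>\<cdot>\<parallel>\<^sup>-\<^sup>a\<close> with \<open>J > 0\<close> for \<open>f = |\<cdot>|\<^sup>-\<^sup>a\<close>, because branching has positive
  probability; so \<open>u\<close> is summable. Conversely let \<open>u\<close> tend to 0 and take
  \<open>f z = (max |z| d)\<^sup>-\<^sup>a\<close> restricted to \<open>|z| \<le> y\<close>. At a branching, a second positive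
  summand has to be small as well, which makes the terms \<open>T\<^sup>k (R f)\<close> negligible for small \<open>y\<close>, while
  \<open>T\<^sup>n (D f)\<close> is negligible for large \<open>n\<close>. This yields
  \<open>E (max |Z| d)\<^sup>-\<^sup>a \<le> y\<^sup>-\<^sup>a + E (max |Z| d)\<^sup>-\<^sup>a / 2\<close>, uniformly in \<open>d > 0\<close>.
\<close>

section \<open>Negative powers\<close>

text \<open>Unlike \<open>r powr (-a)\<close> this is \<open>\<infinity>\<close> at \<open>r = 0\<close>, hence antitone and multiplicative on \<open>[0, \<infinity>)\<close>.\<close>

definition npow :: "real \<Rightarrow> real \<Rightarrow> ennreal" where
  "npow a r = inverse (ennreal (r powr a))"

lemma npow_mult:
  assumes "0 \<le> r" "0 \<le> s"
  shows "npow a (r * s) = npow a r * npow a s"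
proof -
  have "npow a (r * s) = inverse (ennreal (r powr a) * ennreal (s powr a))"
    using assms by (simp add: npow_def powr_mult ennreal_mult)
  then show ?thesis
    by (simp add: npow_def ennreal_inverse_mult less_top)
qed

lemma npow_eq_powr: "0 < r \<Longrightarrow> npow a r = ennreal (r powr (- a))"
  by (simp add: npow_def inverse_ennreal powr_minus)

lemma npow_pos [simp]: "0 < npow a r"
  by (simp add: npow_def zero_less_iff_neq_zero)

lemma npow_finite: "0 < r \<Longrightarrow> npow a r < \<infinity>"
  by (simp add: npow_eq_powr)

lemma npow_1 [simp]: "npow a 1 = 1"
  by (simp add: npow_def)

text \<open>At \<open>r = 0\<close> the right-hand side is infinite; for positive \<open>r\<close>
  this is monotonicity of powers. The constant stands next to \<open>s\<close> because lower bounds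
  for balanced matrices have the form \<open>r \<le> c * s\<close>.\<close>

lemma npow_le_of_le_mult:
  assumes "0 < a" "0 < c" "0 \<le> r" "r \<le> c * s"
  shows "npow a s \<le> ennreal (c powr a) * npow a r"
proof (cases "r = 0")
  case True
  with assms show ?thesis
    by (simp add: npow_def ennreal_mult_top)
next
  case False
  with assms have r: "0 < r" by simp
  with assms have s: "0 < s"
    by (metis less_le_trans zero_less_mult_pos)
  have "r powr a \<le> (c * s) powr a"
    using assms r by (intro powr_mono2) auto
  then have "s powr (- a) \<le> c powr a * r powr (- a)"
    using r s assms by (simp add: powr_mult powr_minus field_simps)
  then show ?thesis
    using r s by (simp add: npow_eq_powr ennreal_leI flip: ennreal_mult)
qed

lemma npow_antimono: "0 < a \<Longrightarrow> 0 \<le> r \<Longrightarrow> r \<le> s \<Longrightarrow> npow a s \<le> npow a r"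
  using npow_le_of_le_mult[of a 1 r s] by simp

lemma npow_measurable [measurable]: "npow a \<in> borel_measurable borel"
  unfolding npow_def by measurable

text \<open>The cutoff \<open>d\<close> does not scale with \<open>r\<close>, so multiplicativity
  survives only up to the extra summand 1: for \<open>r \<le> 1\<close> one has
  \<open>r * max l d \<le> max s d\<close>, and for \<open>r > 1\<close> already
  \<open>max l d \<le> max s d\<close>.\<close>

lemma npow_max_le:
  assumes "0 < a" "0 \<le> r" "0 \<le> l" "0 < d" "r * l \<le> s"
  shows "npow a (max s d) \<le> (1 + npow a r) * npow a (max l d)"
proof (cases "r \<le> 1")
  case True
  have "r * max l d \<le> max s d"
  proof (cases "l \<le> d")
    case True
    moreover have "r * d \<le> d"
      using \<open>r \<le> 1\<close> assms by (simp add: mult_left_le_one_le)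
    ultimately show ?thesis
      by (simp add: max_def)
  next
    case False
    with assms show ?thesis by (simp add: max_def)
  qed
  then have "npow a (max s d) \<le> npow a (r * max l d)"
    using assms by (intro npow_antimono) (auto simp: le_max_iff_disj)
  also have "\<dots> = npow a r * npow a (max l d)"
    using assms by (intro npow_mult) (auto simp: le_max_iff_disj)
  also have "\<dots> \<le> (1 + npow a r) * npow a (max l d)"
    by (intro mult_right_mono) auto
  finally show ?thesis .
next
  case False
  then have "1 * l \<le> r * l" using assms by (intro mult_right_mono) auto
  then have "npow a (max s d) \<le> npow a (max l d)"
    using assms by (intro npow_antimono max.mono) (auto simp: le_max_iff_disj)
  also have "\<dots> = 1 * npow a (max l d)" by simp
  also have "\<dots> \<le> (1 + npow a r) * npow a (max l d)"
    by (intro mult_right_mono) auto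
  finally show ?thesis .
qed

text \<open>Pulls a loss \<open>t\<close> inside the power out as a constant, so that estimates keep
  the shape of a constant times \<open>1 + npow a r\<close>.\<close>

lemma one_plus_npow_le:
  assumes "0 < a" "0 \<le> r" "0 < t"
  shows "1 + npow a (r / t) \<le> (1 + ennreal (t powr a)) * (1 + npow a r)"
proof -
  have "npow a (r / t) \<le> ennreal (t powr a) * npow a r"
    using assms by (intro npow_le_of_le_mult) auto
  then have "1 + npow a (r / t) \<le> 1 + ennreal (t powr a) * npow a r"
    by (rule add_left_mono)
  also have "\<dots> \<le> (1 + ennreal (t powr a)) * (1 + npow a r)"
    by (simp add: distrib_left distrib_right add.assoc add_left_mono add_increasing)
  finally show ?thesis .
qed

section \<open>Operator norm and balanced matrices\<close>

definition colsum :: "('d::finite) mat \<Rightarrow> 'd \<Rightarrow> real" where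
  "colsum x j = (\<Sum>i\<in>UNIV. x $ i $ j)"

text \<open>Column sums are compared rather than entries: the identity, where every product starts,
  can have zero entries but equal column sums, and the property survives multiplication on the right
  by a matrix as in (C8), with the same \<open>c\<close>.\<close>

definition balanced :: "real \<Rightarrow> ('d::finite) mat \<Rightarrow> bool" where
  "balanced c x \<longleftrightarrow> nonneg_mat x \<and> (\<forall>j k. 0 < colsum x j \<and> colsum x j \<le> c * colsum x k)"

lemma l1norm_nonneg [simp]: "0 \<le> l1norm x"
  by (simp add: l1norm_def sum_nonneg)

lemma l1norm_eq_0_iff [simp]: "l1norm x = 0 \<longleftrightarrow> x = 0"
  by (auto simp: l1norm_def sum_nonneg_eq_0_iff vec_eq_iff)

lemma l1norm_pos_iff: "0 < l1norm x \<longleftrightarrow> x \<noteq> 0"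
  by (metis l1norm_nonneg l1norm_eq_0_iff less_eq_real_def less_irrefl)

lemma l1norm_measurable [measurable]: "l1norm \<in> borel_measurable borel"
  unfolding l1norm_def
  by (intro borel_measurable_continuous_onI continuous_intros)

lemma l1norm_mono:
  assumes "\<And>i. 0 \<le> x $ i" "\<And>i. x $ i \<le> y $ i"
  shows "l1norm x \<le> l1norm y"
  unfolding l1norm_def
proof (rule sum_mono)
  fix i show "\<bar>x $ i\<bar> \<le> \<bar>y $ i\<bar>"
    using assms(1)[of i] assms(2)[of i] by linarith
qed

lemma Max_column_upper:
  "l1norm (column j x) \<le> Max (range (\<lambda>j. l1norm (column j x)))"
  by (rule Max_ge) auto

lemma l1norm_mv_le_Max:
  "l1norm (x *v z) \<le> Max (range (\<lambda>j. l1norm (column j x))) * l1norm z"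
proof -
  have "l1norm (x *v z) \<le> (\<Sum>i\<in>UNIV. \<Sum>j\<in>UNIV. \<bar>x $ i $ j\<bar> * \<bar>z $ j\<bar>)"
    unfolding l1norm_def matrix_vector_mult_def
    by (auto intro!: sum_mono order_trans[OF sum_abs] simp: abs_mult)
  also have "\<dots> = (\<Sum>j\<in>UNIV. l1norm (column j x) * \<bar>z $ j\<bar>)"
    by (subst sum.swap) (simp add: l1norm_def column_def sum_distrib_right)
  also have "\<dots> \<le> (\<Sum>j\<in>UNIV. Max (range (\<lambda>j. l1norm (column j x))) * \<bar>z $ j\<bar>)"
    by (intro sum_mono mult_right_mono Max_column_upper) auto
  finally show ?thesis
    by (simp add: l1norm_def sum_distrib_left)
qed

lemma l1norm_axis [simp]: "l1norm (axis j 1) = 1"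
  by (simp add: l1norm_def axis_def if_distrib cong: if_cong)

text \<open>By the triangle inequality the supremum over the l1 unit sphere is attained at a basis
  vector, that is, at a column. The finite maximum also yields measurability.\<close>

lemma opnorm_eq_Max: "opnorm x = Max (range (\<lambda>j. l1norm (column j x)))"
proof (rule antisym)
  have ne: "{z::real^'a. l1norm z = 1} \<noteq> {}"
    using l1norm_axis by blast
  show "opnorm x \<le> Max (range (\<lambda>j. l1norm (column j x)))"
    unfolding opnorm_def
  proof (rule cSUP_least[OF ne])
    fix z :: "real^'a" assume "z \<in> {z. l1norm z = 1}"
    then show "l1norm (x *v z) \<le> Max (range (\<lambda>j. l1norm (column j x)))"
      using l1norm_mv_le_Max[of x z] by simp
  qed
  have "Max (range (\<lambda>j. l1norm (column j x))) \<in> range (\<lambda>j. l1norm (column j x))"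
    by (rule Max_in) auto
  then obtain j where j: "Max (range (\<lambda>j. l1norm (column j x))) = l1norm (column j x)"
    by blast
  show "Max (range (\<lambda>j. l1norm (column j x))) \<le> opnorm x"
    unfolding j opnorm_def
  proof (rule cSUP_upper2[where x = "axis j 1"])
    show "bdd_above ((\<lambda>z. l1norm (x *v z)) ` {z. l1norm z = 1})"
      by (rule bdd_aboveI[where M = "Max (range (\<lambda>j. l1norm (column j x)))"])
         (use l1norm_mv_le_Max[of x] in \<open>auto, metis mult.right_neutral\<close>)
  qed (auto simp: matrix_vector_mul_component matrix_vector_mult_basis)
qed

lemma opnorm_eq_column: obtains j where "opnorm x = l1norm (column j x)"
proof -
  have "opnorm x \<in> range (\<lambda>j. l1norm (column j x))"
    unfolding opnorm_eq_Max by (rule Max_in) auto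
  then show ?thesis using that by blast
qed

lemma l1norm_column_le: "l1norm (column j x) \<le> opnorm x"
  unfolding opnorm_eq_Max by (rule Max_column_upper)

lemma opnorm_nonneg [simp]: "0 \<le> opnorm x"
  using l1norm_column_le[of undefined x] l1norm_nonneg order_trans by blast

lemma l1norm_mv_le: "l1norm (x *v z) \<le> opnorm x * l1norm z"
  unfolding opnorm_eq_Max by (rule l1norm_mv_le_Max)

lemma column_matrix_mult: "column j (x ** y) = x *v column j y"
  by (simp add: column_def matrix_matrix_mult_def matrix_vector_mult_def vec_eq_iff)

lemma opnorm_mult_le: "opnorm (x ** y) \<le> opnorm x * opnorm y"
proof -
  obtain j where "opnorm (x ** y) = l1norm (column j (x ** y))"
    by (rule opnorm_eq_column)
  also have "\<dots> \<le> opnorm x * l1norm (column j y)"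
    unfolding column_matrix_mult by (rule l1norm_mv_le)
  also have "\<dots> \<le> opnorm x * opnorm y"
    by (intro mult_left_mono l1norm_column_le) auto
  finally show ?thesis .
qed

lemma l1norm_column: "nonneg_mat x \<Longrightarrow> l1norm (column j x) = colsum x j"
  by (simp add: l1norm_def colsum_def column_def nonneg_mat_def)

lemma opnorm_mat_1 [simp]: "opnorm (mat 1) = 1"
proof -
  have "l1norm (column j (mat 1)) = 1" for j :: 'a
    by (simp add: l1norm_def column_def mat_def if_distrib cong: if_cong)
  then show ?thesis by (simp add: opnorm_eq_Max)
qed

lemma opnorm_measurable [measurable]: "(opnorm :: 'd::finite mat \<Rightarrow> real) \<in> borel_measurable borel"
proof -
  have "(\<lambda>x::'d mat. l1norm (column j x)) \<in> borel_measurable borel" for j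
    unfolding l1norm_def column_def
    by (intro borel_measurable_continuous_onI continuous_intros) 
  then have "(\<lambda>x::'d mat. Max ((\<lambda>j. l1norm (column j x)) ` UNIV)) \<in> borel_measurable borel"
    by (intro borel_measurable_Max) auto
  then show ?thesis
    by (simp add: opnorm_eq_Max[abs_def])
qed

lemma matrix_mult_measurable [measurable (raw)]:
  fixes f g :: "'w \<Rightarrow> ('d::finite) mat"
  assumes "f \<in> borel_measurable M" "g \<in> borel_measurable M"
  shows "(\<lambda>w. f w ** g w) \<in> borel_measurable M"
proof (rule borel_measurable_continuous_Pair[OF assms])
  show "continuous_on UNIV (\<lambda>x. fst x ** snd x :: 'd mat)"
    unfolding matrix_matrix_mult_def by (intro continuous_intros)
qed

lemma matrix_vector_mult_measurable [measurable (raw)]: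
  fixes f :: "'w \<Rightarrow> ('d::finite) mat"
  assumes "f \<in> borel_measurable M" "g \<in> borel_measurable M"
  shows "(\<lambda>w. f w *v g w) \<in> borel_measurable M"
proof (rule borel_measurable_continuous_Pair[OF assms])
  show "continuous_on UNIV (\<lambda>x. fst x *v snd x :: real^'d)"
    unfolding matrix_vector_mult_def by (intro continuous_intros)
qed

section \<open>Lower bounds for products of nonnegative and balanced matrices\<close>

lemma colsum_mult: "colsum (x ** y) j = (\<Sum>k\<in>UNIV. colsum x k * y $ k $ j)"
  by (simp add: colsum_def matrix_matrix_mult_def sum_distrib_right)
     (subst sum.swap, simp)

lemma l1norm_mv_nonneg:
  assumes "nonneg_mat x" "\<And>i. 0 \<le> z $ i"
  shows "l1norm (x *v z) = (\<Sum>j\<in>UNIV. colsum x j * z $ j)"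
proof -
  have "l1norm (x *v z) = (\<Sum>i\<in>UNIV. \<Sum>j\<in>UNIV. x $ i $ j * z $ j)"
    using assms unfolding l1norm_def matrix_vector_mult_def nonneg_mat_def
    by (auto intro!: sum.cong abs_of_nonneg sum_nonneg)
  also have "\<dots> = (\<Sum>j\<in>UNIV. colsum x j * z $ j)"
    by (subst sum.swap) (simp add: colsum_def sum_distrib_right)
  finally show ?thesis .
qed

lemma nonneg_mat_mult: "nonneg_mat x \<Longrightarrow> nonneg_mat y \<Longrightarrow> nonneg_mat (x ** y)"
  by (auto simp: nonneg_mat_def matrix_matrix_mult_def intro!: sum_nonneg)

lemma mv_nonneg: "nonneg_mat x \<Longrightarrow> (\<And>i. 0 \<le> z $ i) \<Longrightarrow> 0 \<le> (x *v z) $ i"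
  by (auto simp: nonneg_mat_def matrix_vector_mult_def intro!: sum_nonneg)

lemma mv_pos:
  assumes "nonneg_mat x" "\<And>i. 0 \<le> z $ i" "0 < x $ i $ j" "0 < z $ j"
  shows "0 < (x *v z) $ i"
proof -
  have "0 < (\<Sum>j\<in>UNIV. x $ i $ j * z $ j)"
  proof (rule sum_pos2[where i = j])
    show "0 \<le> x $ i $ k * z $ k" for k
      using assms by (simp add: nonneg_mat_def)
  qed (use assms in auto)
  then show ?thesis by (simp add: matrix_vector_mult_def)
qed

lemma balancedD:
  assumes "balanced c x"
  shows "nonneg_mat x" "0 < colsum x j" "colsum x j \<le> c * colsum x k"
  using assms by (auto simp: balanced_def)

lemma balanced_mat_1: "1 \<le> c \<Longrightarrow> balanced c (mat 1)"
proof -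
  have "colsum (mat 1) j = 1" for j :: 'a
    by (simp add: colsum_def mat_def if_distrib cong: if_cong)
  then show "1 \<le> c \<Longrightarrow> balanced c (mat 1 :: 'a mat)"
    by (simp add: balanced_def nonneg_mat_def mat_def)
qed

lemma balanced_opnorm_pos: "balanced c x \<Longrightarrow> 0 < opnorm x"
  using l1norm_column_le[of undefined x] balancedD[of c x]
  by (metis l1norm_column less_le_trans)

lemma opnorm_le_colsum:
  assumes "balanced c x" shows "opnorm x \<le> c * colsum x j"
  using assms opnorm_eq_column[of x] balancedD[OF assms] by (metis l1norm_column)

text \<open>Without cancellation, \<open>l1norm (x *v z)\<close> is the sum of the entries of
  \<open>z\<close> weighted by the column sums of \<open>x\<close>. The operator norm is one of
  these column sums, hence at most \<open>c\<close> times each of them.\<close>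

lemma balanced_mv_ge:
  assumes x: "balanced c x" and z: "\<And>i. 0 \<le> z $ i"
  shows "opnorm x * l1norm z \<le> c * l1norm (x *v z)"
proof -
  have "opnorm x * l1norm z = (\<Sum>j\<in>UNIV. opnorm x * z $ j)"
    using z by (simp add: l1norm_def sum_distrib_left)
  also have "\<dots> \<le> (\<Sum>j\<in>UNIV. c * colsum x j * z $ j)"
    by (intro sum_mono mult_right_mono opnorm_le_colsum[OF x] z)
  also have "\<dots> = c * l1norm (x *v z)"
    using l1norm_mv_nonneg[OF balancedD(1)[OF x] z] by (simp add: sum_distrib_left mult.assoc)
  finally show ?thesis .
qed

lemma balanced_opnorm_mult_ge:
  assumes x: "balanced c x" and y: "nonneg_mat y" and c: "0 \<le> c"
  shows "opnorm x * opnorm y \<le> c * opnorm (x ** y)"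
proof -
  obtain j where j: "opnorm y = l1norm (column j y)"
    by (rule opnorm_eq_column)
  have "opnorm x * opnorm y \<le> c * l1norm (x *v column j y)"
    unfolding j using y by (intro balanced_mv_ge[OF x]) (auto simp: nonneg_mat_def column_def)
  also have "\<dots> \<le> c * opnorm (x ** y)"
    unfolding column_matrix_mult[symmetric] by (intro mult_left_mono l1norm_column_le c)
  finally show ?thesis .
qed

text \<open>Replacing column \<open>j\<close> of \<open>y\<close> by column \<open>k\<close> costs a
  factor \<open>c\<close> entry by entry, while the column sums of \<open>x\<close> only enter as
  positive weights. Hence the constant does not grow along a product.\<close>

lemma balanced_mult:
  assumes x: "balanced c x" and y: "nonneg_mat y"
    and y0: "\<And>i j. 0 < y $ i $ j" and yc: "\<And>i j k. y $ i $ j \<le> c * y $ i $ k"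
  shows "balanced c (x ** y)"
  unfolding balanced_def
proof (intro conjI allI)
  show "nonneg_mat (x ** y)"
    using balancedD(1)[OF x] y by (rule nonneg_mat_mult)
  fix j k
  show "0 < colsum (x ** y) j"
    unfolding colsum_mult using balancedD(2)[OF x] y0 by (intro sum_pos) auto
  have "colsum (x ** y) j \<le> (\<Sum>i\<in>UNIV. colsum x i * (c * y $ i $ k))"
    unfolding colsum_mult using balancedD(2)[OF x] yc
    by (intro sum_mono mult_left_mono) (auto intro: less_imp_le)
  then show "colsum (x ** y) j \<le> c * colsum (x ** y) k"
    unfolding colsum_mult by (simp add: sum_distrib_left mult.left_commute)
qed

lemma mprod_cong: "(\<And>i. i < n \<Longrightarrow> f i = g i) \<Longrightarrow> mprod f n = mprod g n"
  by (induction n) auto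

lemma mprod_measurable:
  assumes "sets L = sets borel" "{..<n} \<subseteq> I"
  shows "(\<lambda>B. mprod B n) \<in> borel_measurable (PiM I (\<lambda>_. L))"
  using assms(2)
proof (induction n)
  case (Suc n)
  have "(\<lambda>B. B n) \<in> measurable (PiM I (\<lambda>_. L)) L"
    using Suc.prems by (intro measurable_component_singleton) auto
  then have "(\<lambda>B. B n) \<in> borel_measurable (PiM I (\<lambda>_. L))"
    using assms(1) by (simp cong: measurable_cong_sets)
  moreover have "(\<lambda>B. mprod B n) \<in> borel_measurable (PiM I (\<lambda>_. L))"
    using Suc by (auto simp: lessThan_Suc)
  ultimately show ?case by simp
qed simp

section \<open>Roots of quasi-multiplicative sequences\<close>

text \<open>The logarithm of \<open>u\<close> is additive up to \<open>K = ln C\<close>, so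
  \<open>w n / n\<close> is Cauchy and lies within \<open>K / n\<close> of its limit. This rate is
  what decides whether \<open>l < 1\<close> in both directions.\<close>

lemma quasi_multiplicative_root_limit:
  fixes u :: "nat \<Rightarrow> real"
  assumes pos: "\<And>n. 0 < u n" and C: "1 \<le> C"
    and lower: "\<And>m n. u m * u n \<le> u (m + n)"
    and upper: "\<And>m n. u (m + n) \<le> C * (u m * u n)"
  obtains l where "(\<lambda>n. u n powr (1 / real n)) \<longlonglongrightarrow> l" and "l < 1 \<longleftrightarrow> u \<longlonglongrightarrow> 0"
proof -
  define w where "w n = ln (u n)" for n
  define K where "K = ln C"
  have K: "0 \<le> K" using C by (simp add: K_def)
  have w_add: "\<bar>w (m + n) - (w m + w n)\<bar> \<le> K" for m n
  proof -
    have "ln (u m * u n) \<le> ln (u (m + n))"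
      using lower pos by (intro ln_mono) auto
    moreover have "ln (u (m + n)) \<le> ln (C * (u m * u n))"
      using upper[of m n] pos C by (intro ln_mono) auto
    ultimately show ?thesis
      using pos C K by (simp add: ln_mult w_def K_def less_imp_neq[symmetric] abs_le_iff)
  qed
  \<comment> \<open>Counting \<open>Suc k\<close> blocks avoids the empty sum: \<open>w 0\<close> is
    only known to be at most \<open>K\<close> in absolute value.\<close>
  have w_mult: "\<bar>w (Suc k * n) - Suc k * w n\<bar> \<le> Suc k * K" for k n
  proof (induction k)
    case (Suc k)
    have "w (Suc (Suc k) * n) = w (n + Suc k * n)" by simp
    with w_add[of n "Suc k * n"] Suc show ?case
      by (simp add: algebra_simps abs_le_iff del: mult_Suc)
  qed (use K in simp)
  have w_ratio: "\<bar>w (n * k) / (n * k) - w n / n\<bar> \<le> K / n" if "0 < n" "0 < k" for n k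
  proof -
    obtain l where "k = Suc l" using \<open>0 < k\<close> by (cases k) auto
    then have "\<bar>w (n * k) - k * w n\<bar> \<le> k * K"
      using w_mult[of l n] by (simp add: mult.commute)
    moreover have "\<bar>w (n * k) / (n * k) - w n / n\<bar> = \<bar>w (n * k) - k * w n\<bar> / (n * k)"
    proof -
      have "w (n * k) / (n * k) - w n / n = (w (n * k) - k * w n) / (n * k)"
        using that by (simp add: field_simps)
      then show ?thesis using that by simp
    qed
    ultimately show ?thesis
      using that by (simp add: field_simps)
  qed
  \<comment> \<open>Both averages are compared with the average at the common multiple
    \<open>n * k\<close>.\<close>
  have close: "\<bar>w n / n - w k / k\<bar> \<le> K / n + K / k" if "0 < n" "0 < k" for n k
  proof -
    have tri: "\<bar>x - y\<bar> \<le> p + q" if "\<bar>z - x\<bar> \<le> p" "\<bar>z - y\<bar> \<le> q" for x y z p q :: real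
      using that by linarith
    show ?thesis
      by (rule tri[OF w_ratio[OF that]]) (use w_ratio[OF that(2,1)] in \<open>simp add: mult.commute\<close>)
  qed
  have "Cauchy (\<lambda>n. w n / n)"
  proof (rule metric_CauchyI)
    fix e :: real assume e: "0 < e"
    obtain m :: nat where m: "2 * K / e < m" using reals_Archimedean2 by blast
    have "dist (w i / i) (w j / j) < e" if "Suc m \<le> i" "Suc m \<le> j" for i j
    proof -
      have "K / n < e / 2" if "Suc m \<le> n" for n
      proof -
        have "2 * K / e < n" using m that by linarith
        then show ?thesis using e that by (simp add: field_simps)
      qed
      from this[OF that(1)] this[OF that(2)] have "K / i < e / 2" "K / j < e / 2" .
      moreover have "\<bar>w i / i - w j / j\<bar> \<le> K / i + K / j"
        by (rule close) (use that in auto)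
      ultimately show ?thesis
        unfolding dist_real_def by linarith
    qed
    then show "\<exists>M. \<forall>i\<ge>M. \<forall>j\<ge>M. dist (w i / i) (w j / j) < e"
      by blast
  qed
  then obtain L where L: "(\<lambda>n. w n / n) \<longlonglongrightarrow> L"
    using Cauchy_convergent_iff convergent_def by blast
  have near: "\<bar>w n / n - L\<bar> \<le> K / n" if "0 < n" for n
  proof (rule LIMSEQ_le_const2)
    show "(\<lambda>k. \<bar>w n / n - w k / k\<bar> - K / k) \<longlonglongrightarrow> \<bar>w n / n - L\<bar>"
    proof -
      have "(\<lambda>k. \<bar>w n / n - w k / k\<bar> - K / k) \<longlonglongrightarrow> \<bar>w n / n - L\<bar> - 0"
        by (intro tendsto_intros L lim_const_over_n)
      then show ?thesis by simp
    qed
    show "\<exists>N. \<forall>k\<ge>N. \<bar>w n / n - w k / k\<bar> - K / k \<le> K / n"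
    proof (intro exI[of _ 1] allI impI)
      fix k :: nat assume "1 \<le> k"
      then have "\<bar>w n / n - w k / k\<bar> \<le> K / n + K / k"
        by (intro close that) auto
      then show "\<bar>w n / n - w k / k\<bar> - K / k \<le> K / n" by linarith
    qed
  qed
  have "(\<lambda>n. exp (w n / n)) \<longlonglongrightarrow> exp L"
    by (intro tendsto_exp L)
  moreover have "u n powr (1 / n) = exp (w n / n)" for n
    using pos[of n] by (simp add: powr_def w_def)
  ultimately have lim: "(\<lambda>n. u n powr (1 / n)) \<longlonglongrightarrow> exp L"
    by simp
  moreover have "exp L < 1 \<longleftrightarrow> u \<longlonglongrightarrow> 0"
  proof
    assume "exp L < 1"
    then have "L < 0" by simp
    have "norm (u n) \<le> C * exp L ^ n" for n
    proof (cases "n = 0")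
      \<comment> \<open>The rate bound \<open>near\<close> starts at \<open>n = 1\<close>; at 0,
        \<open>u 0 * u 0 \<le> u 0\<close> gives \<open>u 0 \<le> 1\<close>.\<close>
      case True
      have "u 0 * u 0 \<le> u 0 * 1" using lower[of 0 0] by simp
      then have "u 0 \<le> 1" using pos[of 0] mult_le_cancel_left_pos by blast
      then show ?thesis using C True pos[of 0] by simp
    next
      case False
      then have "w n \<le> K + n * L"
        using near[of n] by (simp add: field_simps abs_le_iff)
      then have "exp (w n) \<le> exp (K + n * L)" by simp
      then show ?thesis
        using pos[of n] C by (simp add: w_def K_def exp_add exp_of_nat_mult)
    qed
    moreover have "(\<lambda>n. C * exp L ^ n) \<longlonglongrightarrow> 0"
      using \<open>exp L < 1\<close> by (intro tendsto_mult_right_zero LIMSEQ_realpow_zero) auto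
    ultimately show "u \<longlonglongrightarrow> 0"
      by (rule Lim_null_comparison[OF always_eventually[OF allI]])
  next
    assume "u \<longlonglongrightarrow> 0"
    \<comment> \<open>A single positive index with \<open>C * u n < 1\<close> suffices, since there
      \<open>n * L \<le> ln (C * u n) < 0\<close>.\<close>
    then have "eventually (\<lambda>n. u n < 1 / C) sequentially"
      using C by (intro order_tendstoD) auto
    moreover have "eventually (\<lambda>n. 0 < n) sequentially"
      by (rule eventually_gt_at_top)
    ultimately have "eventually (\<lambda>n. u n < 1 / C \<and> 0 < n) sequentially"
      by (rule eventually_conj)
    then obtain n where n: "u n < 1 / C" "0 < n"
      by (auto simp: eventually_sequentially)
    then have "C * u n < 1" using C by (simp add: field_simps)
    then have "ln (C * u n) < 0" using C pos[of n] by simp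
    then have "w n + K < 0"
      using C pos[of n] by (simp add: ln_mult w_def K_def)
    moreover have "n * L \<le> w n + K"
      using near[of n] n by (simp add: field_simps abs_le_iff)
    ultimately have "n * L < 0" by linarith
    then show "exp L < 1" using n by (simp add: mult_less_0_iff)
  qed
  ultimately show thesis by (rule that)
qed

section \<open>The smoothing equation\<close>

lemma (in prob_space) nn_integral_PiM_nat_component:
  assumes f: "f \<in> borel_measurable M"
  shows "(\<integral>\<^sup>+ z. f (z (i::nat)) \<partial>PiM UNIV (\<lambda>_. M)) = (\<integral>\<^sup>+ z. f z \<partial>M)"
proof -
  have "distr (PiM UNIV (\<lambda>_. M)) M (\<lambda>z. z i) = M"
    by (rule distr_PiM_component) (auto intro: prob_space_axioms)
  then have "(\<integral>\<^sup>+ z. f z \<partial>M) = (\<integral>\<^sup>+ z. f z \<partial>distr (PiM UNIV (\<lambda>_. M)) M (\<lambda>z. z i))"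
    by simp
  also have "\<dots> = (\<integral>\<^sup>+ z. f (z i) \<partial>PiM UNIV (\<lambda>_. M))"
    using f by (intro nn_integral_distr) auto
  finally show ?thesis by simp
qed

text \<open>Independence of two coordinates: the infinite product projects onto the finite product
  over \<open>{i, j}\<close>, where the integral factorizes.\<close>

lemma (in prob_space) nn_integral_PiM_nat_component2:
  assumes f: "f \<in> borel_measurable M" and g: "g \<in> borel_measurable M" and ij: "i \<noteq> (j::nat)"
  shows "(\<integral>\<^sup>+ z. f (z i) * g (z j) \<partial>PiM UNIV (\<lambda>_. M)) = (\<integral>\<^sup>+ z. f z \<partial>M) * (\<integral>\<^sup>+ z. g z \<partial>M)"
proof -
  interpret P: product_prob_space "\<lambda>_::nat. M" UNIV
    by unfold_locales
  define h where "h k = (if k = i then f else g)" for k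
  have h: "h k \<in> borel_measurable M" for k
    using f g by (simp add: h_def)
  have "(\<integral>\<^sup>+ z. f z \<partial>M) * (\<integral>\<^sup>+ z. g z \<partial>M) = (\<Prod>k\<in>{i, j}. \<integral>\<^sup>+ z. h k z \<partial>M)"
    using ij by (simp add: h_def)
  also have "\<dots> = (\<integral>\<^sup>+ z. (\<Prod>k\<in>{i, j}. h k (z k)) \<partial>PiM {i, j} (\<lambda>_. M))"
    using h by (intro P.product_nn_integral_prod[symmetric]) auto
  also have "\<dots> = (\<integral>\<^sup>+ z. (\<Prod>k\<in>{i, j}. h k (z k))
                     \<partial>distr (PiM UNIV (\<lambda>_. M)) (PiM {i, j} (\<lambda>_. M)) (\<lambda>z. restrict z {i, j}))"
    by (subst P.distr_PiM_restrict_finite) auto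
  also have "\<dots> = (\<integral>\<^sup>+ z. (\<Prod>k\<in>{i, j}. h k (restrict z {i, j} k)) \<partial>PiM UNIV (\<lambda>_. M))"
  proof -
    have "(\<lambda>z. restrict z {i, j}) \<in> measurable (PiM UNIV (\<lambda>_. M)) (PiM {i, j} (\<lambda>_. M))"
      by (rule measurable_restrict_subset) simp
    moreover have "(\<lambda>z. \<Prod>k\<in>{i, j}. h k (z k)) \<in> borel_measurable (PiM {i, j} (\<lambda>_. M))"
      using h by (intro borel_measurable_prod_ennreal measurable_compose[OF measurable_component_singleton]) auto
    ultimately show ?thesis
      by (simp only: nn_integral_distr measurable_distr_eq1)
  qed
  also have "\<dots> = (\<integral>\<^sup>+ z. f (z i) * g (z j) \<partial>PiM UNIV (\<lambda>_. M))"
    using ij by (simp add: h_def)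
  finally show ?thesis ..
qed

text \<open>The setting in the form the argument works with: (C8) as comparability of all entries of
  \<open>A 1\<close>, mean of \<open>N\<close> above 1 as branching with positive probability, and
  the support condition as a nonzero second matrix at a branching.\<close>

locale smoothing = M: prob_space M + mu: prob_space \<mu>
  for M :: "'w measure" and \<mu> :: "(real ^ 'd::finite) measure" +
  fixes N :: "'w \<Rightarrow> nat" and A :: "nat \<Rightarrow> 'w \<Rightarrow> 'd mat" and a c :: real
  assumes N_meas [measurable]: "N \<in> measurable M (count_space UNIV)"
    and A_meas [measurable]: "\<And>i. A i \<in> borel_measurable M"
    and N_ge: "AE \<omega> in M. 1 \<le> N \<omega>"
    and N_branching: "\<not> (AE \<omega> in M. N \<omega> = 1)"
    and A_nonneg: "AE \<omega> in M. \<forall>i. nonneg_mat (A i \<omega>)"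
    and A2_nonzero: "AE \<omega> in M. 2 \<le> N \<omega> \<longrightarrow> A 2 \<omega> \<noteq> 0"
    and c_ge: "1 \<le> c"
    and A1_entries: "AE \<omega> in M. \<forall>i j k l. 0 < A 1 \<omega> $ i $ j \<and> A 1 \<omega> $ i $ j \<le> c * A 1 \<omega> $ k $ l"
    and mu_sets [measurable_cong]: "sets \<mu> = sets borel"
    and mu_nonneg: "AE z in \<mu>. \<forall>i. 0 \<le> z $ i"
    and mu_nonzero: "AE z in \<mu>. z \<noteq> 0"
    and mu_fix: "\<mu> = distr (M \<Otimes>\<^sub>M PiM UNIV (\<lambda>_::nat. \<mu>)) borel
                       (\<lambda>(\<omega>, zs). \<Sum>i\<in>{1..N \<omega>}. A i \<omega> *v zs i)"
    and a_pos: "0 < a"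
    and A1_moment: "(\<integral>\<^sup>+ \<omega>. npow a (opnorm (A 1 \<omega>)) \<partial>M) < \<infinity>"
begin

abbreviation P :: "(nat \<Rightarrow> real ^ 'd) measure" where
  "P \<equiv> PiM UNIV (\<lambda>_. \<mu>)"

sublocale P: prob_space P
  by (rule prob_space_PiM) (rule mu.prob_space_axioms)

definition Y :: "'w \<Rightarrow> (nat \<Rightarrow> real ^ 'd) \<Rightarrow> real ^ 'd" where
  "Y \<omega> zs = (\<Sum>i\<in>{1..N \<omega>}. A i \<omega> *v zs i)"

definition D :: "(real ^ 'd \<Rightarrow> ennreal) \<Rightarrow> 'd mat \<Rightarrow> ennreal" where
  "D f x = (\<integral>\<^sup>+ z. f (x *v z) \<partial>\<mu>)"

text \<open>The transfer operator of unbranched steps: \<open>x\<close> is the product collected so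
  far along a line of single children, and each further step multiplies it on the right.\<close>

definition T :: "('d mat \<Rightarrow> ennreal) \<Rightarrow> 'd mat \<Rightarrow> ennreal" where
  "T g x = (\<integral>\<^sup>+ \<omega>. (if N \<omega> = 1 then g (x ** A 1 \<omega>) else 0) \<partial>M)"

definition R :: "(real ^ 'd \<Rightarrow> ennreal) \<Rightarrow> 'd mat \<Rightarrow> ennreal" where
  "R f x = (\<integral>\<^sup>+ \<omega>. (\<integral>\<^sup>+ zs. (if 2 \<le> N \<omega> then f (x *v Y \<omega> zs) else 0) \<partial>P) \<partial>M)"

lemma Y_measurable [measurable]: "(\<lambda>(\<omega>, zs). Y \<omega> zs) \<in> borel_measurable (M \<Otimes>\<^sub>M P)"
proof -
  have "(\<lambda>x. \<Sum>i\<in>{1..n}. A i (fst x) *v snd x i) \<in> borel_measurable (M \<Otimes>\<^sub>M P)" for n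
    by measurable
  moreover have "(\<lambda>x. N (fst x)) \<in> measurable (M \<Otimes>\<^sub>M P) (count_space UNIV)"
    by measurable
  ultimately have "(\<lambda>x. \<Sum>i\<in>{1..N (fst x)}. A i (fst x) *v snd x i) \<in> borel_measurable (M \<Otimes>\<^sub>M P)"
    by (rule measurable_compose_countable)
  then show ?thesis
    by (simp add: Y_def case_prod_beta')
qed

lemma D_measurable [measurable]:
  assumes [measurable]: "f \<in> borel_measurable borel" shows "D f \<in> borel_measurable borel"
  unfolding D_def by measurable

lemma T_measurable [measurable]:
  assumes [measurable]: "g \<in> borel_measurable borel" shows "T g \<in> borel_measurable borel"
  unfolding T_def by measurable

lemma R_measurable [measurable]:
  assumes [measurable]: "f \<in> borel_measurable borel" shows "R f \<in> borel_measurable borel"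
  unfolding R_def by measurable

lemma T_funpow_measurable [measurable]:
  "g \<in> borel_measurable borel \<Longrightarrow> (T ^^ n) g \<in> borel_measurable borel"
  by (induction n) auto

text \<open>Insert the fixed-point equation and split by \<open>N\<close>. For \<open>N = 1\<close>
  the sum is \<open>A 1 \<omega> *v zs 1\<close>, and integrating out \<open>zs\<close> gives
  \<open>D f\<close> at the extended product.\<close>

lemma D_eq:
  assumes [measurable]: "f \<in> borel_measurable borel"
  shows "D f x = T (D f) x + R f x"
proof -
  have "D f x = (\<integral>\<^sup>+ z. f (x *v z) \<partial>distr (M \<Otimes>\<^sub>M P) borel (\<lambda>(\<omega>, zs). Y \<omega> zs))"
    unfolding D_def Y_def by (rule arg_cong2[where f = nn_integral, OF mu_fix refl])
  also have "\<dots> = (\<integral>\<^sup>+ p. f (x *v Y (fst p) (snd p)) \<partial>(M \<Otimes>\<^sub>M P))"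
    by (subst nn_integral_distr) (auto simp: case_prod_beta')
  also have "\<dots> = (\<integral>\<^sup>+ \<omega>. (\<integral>\<^sup>+ zs. f (x *v Y \<omega> zs) \<partial>P) \<partial>M)"
    by (subst P.nn_integral_fst[symmetric]) auto
  also have "\<dots> = (\<integral>\<^sup>+ \<omega>. (if N \<omega> = 1 then D f (x ** A 1 \<omega>) else 0) +
                      (\<integral>\<^sup>+ zs. (if 2 \<le> N \<omega> then f (x *v Y \<omega> zs) else 0) \<partial>P) \<partial>M)"
  proof (rule nn_integral_cong_AE, use N_ge in eventually_elim)
    case (elim \<omega>)
    show ?case
    proof (cases "N \<omega> = 1")
      case True
      have "(\<integral>\<^sup>+ zs. f (x *v Y \<omega> zs) \<partial>P) = (\<integral>\<^sup>+ zs. f ((x ** A 1 \<omega>) *v zs 1) \<partial>P)"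
        by (simp add: Y_def True matrix_vector_mul_assoc)
      also have "\<dots> = D f (x ** A 1 \<omega>)"
        unfolding D_def by (rule mu.nn_integral_PiM_nat_component) measurable
      finally show ?thesis using True by simp
    qed (use elim in auto)
  qed
  also have "\<dots> = T (D f) x + R f x"
    unfolding T_def R_def by (rule nn_integral_add) measurable
  finally show ?thesis .
qed

lemma T_add:
  assumes [measurable]: "g \<in> borel_measurable borel" "h \<in> borel_measurable borel"
  shows "T (\<lambda>x. g x + h x) x = T g x + T h x"
  unfolding T_def by (subst nn_integral_add[symmetric]) (auto intro!: nn_integral_cong)

lemma T_cmult:
  assumes [measurable]: "g \<in> borel_measurable borel"
  shows "T (\<lambda>x. k * g x) x = k * T g x"
  unfolding T_def by (subst nn_integral_cmult[symmetric]) (auto intro!: nn_integral_cong)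

lemma T_funpow_add:
  assumes [measurable]: "g \<in> borel_measurable borel" "h \<in> borel_measurable borel"
  shows "(T ^^ n) (\<lambda>x. g x + h x) x = (T ^^ n) g x + (T ^^ n) h x"
proof (induction n arbitrary: x)
  case (Suc n)
  then have "(T ^^ n) (\<lambda>x. g x + h x) = (\<lambda>x. (T ^^ n) g x + (T ^^ n) h x)" by auto
  then show ?case by (simp add: T_add)
qed simp

lemma T_funpow_cmult:
  assumes [measurable]: "g \<in> borel_measurable borel"
  shows "(T ^^ n) (\<lambda>x. k * g x) x = k * (T ^^ n) g x"
proof (induction n arbitrary: x)
  case (Suc n)
  then have "(T ^^ n) (\<lambda>x. k * g x) = (\<lambda>x. k * (T ^^ n) g x)" by auto
  then show ?case by (simp add: T_cmult)
qed simp

lemma D_expand: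
  assumes [measurable]: "f \<in> borel_measurable borel"
  shows "D f x = (T ^^ n) (D f) x + (\<Sum>k<n. (T ^^ k) (R f) x)"
proof (induction n)
  case (Suc n)
  have "(T ^^ n) (D f) x = (T ^^ n) (\<lambda>x. T (D f) x + R f x) x"
    by (rule fun_cong[OF arg_cong[where f = "T ^^ n"]], rule ext, rule D_eq[OF assms])
  also have "\<dots> = (T ^^ Suc n) (D f) x + (T ^^ n) (R f) x"
    by (simp add: T_funpow_add funpow_swap1)
  finally show ?case using Suc by (simp add: ac_simps)
qed simp

lemma A1_balanced_mult:
  "AE \<omega> in M. \<forall>x. balanced c x \<longrightarrow> balanced c (x ** A 1 \<omega>)"
  using A1_entries A_nonneg by eventually_elim (auto intro!: balanced_mult)

lemma A1_balanced: "AE \<omega> in M. balanced c (A 1 \<omega>)"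
  using A1_balanced_mult by eventually_elim (metis balanced_mat_1[OF c_ge] matrix_mul_lid)

text \<open>Balance almost surely survives a step of \<open>T\<close>, so pointwise bounds are
  needed on balanced matrices only.\<close>

lemma T_mono_balanced:
  assumes "\<And>x. balanced c x \<Longrightarrow> g x \<le> h x" "balanced c x"
  shows "T g x \<le> T h x"
  unfolding T_def
  by (rule nn_integral_mono_AE, use A1_balanced_mult in eventually_elim) (use assms in auto)

lemma T_funpow_mono_balanced:
  assumes "\<And>x. balanced c x \<Longrightarrow> g x \<le> h x" "balanced c x"
  shows "(T ^^ n) g x \<le> (T ^^ n) h x"
  using assms(2)
  by (induction n arbitrary: x) (use assms in \<open>auto intro!: T_mono_balanced\<close>)

text \<open>\<open>T\<close> acts by right multiplication and so commutes with left multiplication;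
  this moves any starting matrix to the identity.\<close>

lemma T_funpow_shift: "(T ^^ n) (\<lambda>y. g (x ** y)) y = (T ^^ n) g (x ** y)"
proof (induction n arbitrary: y)
  case (Suc n)
  then have "(T ^^ n) (\<lambda>y. g (x ** y)) = (\<lambda>y. (T ^^ n) g (x ** y))" by auto
  then have "(T ^^ Suc n) (\<lambda>y. g (x ** y)) y = T (\<lambda>y. (T ^^ n) g (x ** y)) y" by simp
  also have "\<dots> = T ((T ^^ n) g) (x ** y)"
    unfolding T_def by (simp only: matrix_mul_assoc)
  finally show ?case by simp
qed simp

section \<open>The weight \<open>G\<close> and its quasi-multiplicative sequence\<close>

definition G :: "'d mat \<Rightarrow> ennreal" where
  "G x = npow a (opnorm x)"

text \<open>Defined through \<open>T\<close> instead of the conditional law, so that it also makes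
  sense when \<open>N = 1\<close> has probability 0.\<close>

definition u :: "nat \<Rightarrow> ennreal" where
  "u n = (T ^^ n) G (mat 1)"

lemma G_measurable [measurable]: "G \<in> borel_measurable borel"
  unfolding G_def by measurable

lemma G_mult_ge: "G x * G y \<le> G (x ** y)"
  unfolding G_def by (subst npow_mult[symmetric]) (auto intro!: npow_antimono a_pos opnorm_mult_le)

lemma G_mult_le:
  assumes "balanced c x" "nonneg_mat y"
  shows "G (x ** y) \<le> ennreal (c powr a) * (G x * G y)"
  unfolding G_def
  by (subst npow_mult[symmetric])
     (use assms a_pos c_ge balanced_opnorm_mult_ge[OF assms] in \<open>auto intro!: npow_le_of_le_mult\<close>)

lemma G_finite: "balanced c x \<Longrightarrow> G x < \<infinity>"
  unfolding G_def by (intro npow_finite balanced_opnorm_pos)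

lemma G_mat_1 [simp]: "G (mat 1) = 1"
  by (simp add: G_def)

lemma one_balanced [simp]: "balanced c (mat 1)"
  by (rule balanced_mat_1[OF c_ge])

text \<open>Up to the factor \<open>c powr a\<close>, \<open>G\<close> is multiplicative on the
  matrices that occur, hence an approximate eigenfunction of \<open>T ^^ n\<close> with eigenvalue
  \<open>u n\<close>. This is the lower half: the norm is submultiplicative and the negative power
  reverses the inequality.\<close>

lemma T_G_ge: "G x * u n \<le> (T ^^ n) G x" if "balanced c x"
proof -
  have "G x * u n = (T ^^ n) (\<lambda>y. G x * G y) (mat 1)"
    by (simp add: u_def T_funpow_cmult)
  also have "\<dots> \<le> (T ^^ n) (\<lambda>y. G (x ** y)) (mat 1)"
    by (intro T_funpow_mono_balanced G_mult_ge) simp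
  finally show ?thesis by (simp add: T_funpow_shift)
qed

lemma T_G_le: "(T ^^ n) G x \<le> ennreal (c powr a) * (G x * u n)" if "balanced c x"
proof -
  have "(T ^^ n) G x = (T ^^ n) (\<lambda>y. G (x ** y)) (mat 1)"
    by (simp add: T_funpow_shift)
  also have "\<dots> \<le> (T ^^ n) (\<lambda>y. ennreal (c powr a) * (G x * G y)) (mat 1)"
    by (intro T_funpow_mono_balanced G_mult_le that) (auto dest: balancedD)
  also have "\<dots> = ennreal (c powr a) * (G x * u n)"
    by (simp add: u_def T_funpow_cmult)
  finally show ?thesis .
qed

lemma u_add_ge: "u m * u n \<le> u (m + n)"
proof -
  have "u m * u n = (T ^^ m) (\<lambda>x. u n * G x) (mat 1)"
    by (simp add: u_def T_funpow_cmult) (simp add: mult.commute)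
  also have "\<dots> \<le> (T ^^ m) ((T ^^ n) G) (mat 1)"
    by (intro T_funpow_mono_balanced) (auto simp: mult.commute T_G_ge)
  finally show ?thesis by (simp add: u_def funpow_add)
qed

lemma u_add_le: "u (m + n) \<le> ennreal (c powr a) * (u m * u n)"
proof -
  have "u (m + n) = (T ^^ m) ((T ^^ n) G) (mat 1)"
    by (simp add: u_def funpow_add)
  also have "\<dots> \<le> (T ^^ m) (\<lambda>x. (ennreal (c powr a) * u n) * G x) (mat 1)"
    using T_G_le by (intro T_funpow_mono_balanced) (auto simp: ac_simps)
  also have "\<dots> = ennreal (c powr a) * (u m * u n)"
    by (subst T_funpow_cmult) (auto simp: u_def ac_simps)
  finally show ?thesis .
qed

lemma u_0 [simp]: "u 0 = 1"
  by (simp add: u_def)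

lemma u_finite: "u n < \<infinity>"
proof (induction n)
  case (Suc n)
  have "u 1 \<le> (\<integral>\<^sup>+ \<omega>. npow a (opnorm (A 1 \<omega>)) \<partial>M)"
    unfolding u_def T_def G_def by (auto intro!: nn_integral_mono)
  then have "u 1 < \<infinity>" using A1_moment by (rule le_less_trans)
  with Suc have "ennreal (c powr a) * (u 1 * u n) < \<infinity>"
    by (simp add: ennreal_mult_less_top)
  then show ?case using u_add_le[of 1 n] le_less_trans by fastforce
qed simp

section \<open>A finite moment forces \<open>u\<close> to vanish\<close>

definition F :: "real ^ 'd \<Rightarrow> ennreal" where
  "F z = npow a (l1norm z)"

lemma F_measurable [measurable]: "F \<in> borel_measurable borel"
  unfolding F_def by measurable

text \<open>The value of \<open>R F\<close> at the identity, that is, the contribution of branching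
  to the negative moment.\<close>

definition J :: ennreal where
  "J = (\<integral>\<^sup>+ \<omega>. (\<integral>\<^sup>+ zs. (if 2 \<le> N \<omega> then F (Y \<omega> zs) else 0) \<partial>P) \<partial>M)"

text \<open>\<open>F\<close> vanishes nowhere, so \<open>J = 0\<close> would rule out
  branching.\<close>

lemma J_pos: "0 < J"
proof (rule ccontr)
  assume "\<not> 0 < J"
  then have "J = 0" by (simp add: zero_less_iff_neq_zero)
  then have "AE \<omega> in M. (\<integral>\<^sup>+ zs. (if 2 \<le> N \<omega> then F (Y \<omega> zs) else 0) \<partial>P) = 0"
    unfolding J_def by (subst (asm) nn_integral_0_iff_AE) measurable
  then have "AE \<omega> in M. N \<omega> = 1"
    using N_ge AE_space
  proof eventually_elim
    case (elim \<omega>)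
    have False if "2 \<le> N \<omega>"
    proof -
      have "(\<lambda>zs. F (Y \<omega> zs)) \<in> borel_measurable P"
        using elim by measurable
      moreover have "(\<integral>\<^sup>+ zs. F (Y \<omega> zs) \<partial>P) = 0"
        using elim that by simp
      ultimately have "AE zs in P. F (Y \<omega> zs) = 0"
        by (simp add: nn_integral_0_iff_AE)
      moreover have "F z \<noteq> 0" for z
        using npow_pos[of a "l1norm z"] by (simp add: F_def zero_less_iff_neq_zero)
      ultimately show False by simp
    qed
    with elim show ?case by fastforce
  qed
  with N_branching show False ..
qed

lemma R_F_ge: "J * G x \<le> R F x"
proof -
  have "F (x *v z) \<ge> G x * F z" for z
    unfolding F_def G_def
    by (subst npow_mult[symmetric]) (auto intro!: npow_antimono a_pos l1norm_mv_le)
  then have "R F x \<ge> (\<integral>\<^sup>+ \<omega>. (\<integral>\<^sup>+ zs. G x * (if 2 \<le> N \<omega> then F (Y \<omega> zs) else 0) \<partial>P) \<partial>M)"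
    unfolding R_def by (intro nn_integral_mono) auto
  also have "(\<integral>\<^sup>+ \<omega>. (\<integral>\<^sup>+ zs. G x * (if 2 \<le> N \<omega> then F (Y \<omega> zs) else 0) \<partial>P) \<partial>M) =
    (\<integral>\<^sup>+ \<omega>. G x * (\<integral>\<^sup>+ zs. (if 2 \<le> N \<omega> then F (Y \<omega> zs) else 0) \<partial>P) \<partial>M)"
    by (intro nn_integral_cong nn_integral_cmult) measurable
  also have "\<dots> = G x * J"
    unfolding J_def by (intro nn_integral_cmult) measurable
  finally show ?thesis by (simp add: mult.commute)
qed

lemma D_F_mat_1: "D F (mat 1) = (\<integral>\<^sup>+ z. F z \<partial>\<mu>)"
  by (simp add: D_def)

text \<open>In the expansion of \<open>D F\<close> at the identity the term without branching is
  dropped, and each branching term is at least \<open>J * u k\<close>.\<close>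

lemma sum_u_le: "J * (\<Sum>k<n. u k) \<le> (\<integral>\<^sup>+ z. F z \<partial>\<mu>)"
proof -
  have "J * (\<Sum>k<n. u k) = (\<Sum>k<n. (T ^^ k) (\<lambda>x. J * G x) (mat 1))"
    by (simp add: u_def T_funpow_cmult sum_distrib_left)
  also have "\<dots> \<le> (\<Sum>k<n. (T ^^ k) (R F) (mat 1))"
    by (intro sum_mono T_funpow_mono_balanced R_F_ge) simp
  also have "\<dots> \<le> D F (mat 1)"
    by (subst D_expand[of _ _ n]) auto
  finally show ?thesis by (simp add: D_F_mat_1)
qed

lemma u_tendsto_0_if_moment:
  assumes "(\<integral>\<^sup>+ z. F z \<partial>\<mu>) < \<infinity>"
  shows "(\<lambda>n. enn2real (u n)) \<longlonglongrightarrow> 0"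
proof -
  define v where "v n = enn2real (u n)" for n
  have v: "u n = ennreal (v n)" "0 \<le> v n" for n
    using u_finite[of n] by (auto simp: v_def)
  obtain K where K: "0 \<le> K" "(\<integral>\<^sup>+ z. F z \<partial>\<mu>) = ennreal K"
    using assms by (metis ennreal_cases infinity_ennreal_def less_irrefl)
  \<comment> \<open>The case of a single term, where \<open>u 0 = 1\<close>.\<close>
  have "J < \<infinity>"
    using sum_u_le[of 1] assms by (simp add: le_less_trans)
  then obtain j where j: "0 < j" "J = ennreal j"
    using J_pos by (metis ennreal_cases infinity_ennreal_def less_irrefl ennreal_less_zero_iff)
  have "summable v"
  proof (rule bounded_imp_summable)
    fix n
    have "ennreal (j * (\<Sum>k\<le>n. v k)) = J * (\<Sum>k<Suc n. u k)"
      using j v by (simp add: ennreal_mult sum_nonneg lessThan_Suc_atMost)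
    also have "\<dots> \<le> ennreal K"
      using sum_u_le[of "Suc n"] K by simp
    finally have "j * (\<Sum>k\<le>n. v k) \<le> K" using K by simp
    then show "(\<Sum>k\<le>n. v k) \<le> K / j" using j by (simp add: field_simps)
  qed (rule v)
  then show ?thesis
    unfolding v_def by (rule summable_LIMSEQ_zero)
qed

section \<open>Vanishing \<open>u\<close> forces a finite moment\<close>

text \<open>One application of the fixed-point equation: \<open>A 1\<close> has positive entries, so
  it maps the nonzero nonnegative vector \<open>zs 1\<close> to a positive one, and the other
  summands are nonnegative. It ensures that a nonzero \<open>A 2\<close> does not annihilate
  \<open>z\<close>.\<close>

lemma mu_positive: "AE z in \<mu>. \<forall>i. 0 < z $ i"
proof -
  interpret MP: pair_prob_space M P ..
  have 1: "AE zs in P. \<forall>n i. 0 \<le> zs n $ i" 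
    unfolding AE_all_countable
    by (intro allI AE_PiM_component mu.prob_space_axioms mu_nonneg[unfolded AE_all_countable, rule_format]) simp
  have 2: "AE zs in P. zs 1 \<noteq> 0"
    by (intro AE_PiM_component mu.prob_space_axioms mu_nonzero) simp
  have "AE p in M \<Otimes>\<^sub>M P. \<forall>i. 0 < Y (fst p) (snd p) $ i"
  proof (rule MP.AE_pair_measure)
    show "{x \<in> space (M \<Otimes>\<^sub>M P). \<forall>i. 0 < Y (fst x) (snd x) $ i} \<in> sets (M \<Otimes>\<^sub>M P)"
      by measurable
    show "AE \<omega> in M. AE zs in P. \<forall>i. 0 < Y (fst (\<omega>, zs)) (snd (\<omega>, zs)) $ i"
      using A1_entries A_nonneg N_ge
    proof eventually_elim
      case (elim \<omega>)
      show ?case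
        using 1 2
      proof eventually_elim
        case z: (elim zs)
        show ?case
        proof
          fix i
          have "\<exists>k. zs 1 $ k \<noteq> 0" using z(2) by (auto simp: vec_eq_iff)
          then obtain k where "0 < zs 1 $ k" using z(1) by (metis order_le_less)
          then have "0 < (A 1 \<omega> *v zs 1) $ i"
            using elim z(1) by (intro mv_pos[where j = k]) auto
          also have "\<dots> \<le> (\<Sum>n\<in>{1..N \<omega>}. (A n \<omega> *v zs n) $ i)"
            using elim z(1) by (intro member_le_sum mv_nonneg) auto
          finally show "0 < Y (fst (\<omega>, zs)) (snd (\<omega>, zs)) $ i"
            by (simp add: Y_def)
        qed
      qed
    qed
  qed
  then have "AE z in distr (M \<Otimes>\<^sub>M P) borel (\<lambda>(\<omega>, zs). Y \<omega> zs). \<forall>i. 0 < z $ i"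
    by (subst AE_distr_iff) (auto simp: case_prod_beta')
  then show ?thesis
    unfolding Y_def mu_fix[symmetric] .
qed

text \<open>The cutoff makes the integral \<open>h d\<close> finite, which allows a multiple of it
  to be absorbed on the left of an inequality.\<close>

definition W :: "real \<Rightarrow> real ^ 'd \<Rightarrow> ennreal" where
  "W d z = npow a (max (l1norm z) d)"

definition h :: "real \<Rightarrow> ennreal" where
  "h d = (\<integral>\<^sup>+ z. W d z \<partial>\<mu>)"

text \<open>The coefficient of \<open>h d\<close> in the bound for a branching term: the first child
  pays the negative power, whence \<open>1 + G (A 1 \<omega>)\<close>, and the truncation at
  \<open>y\<close> forces the second child to be small.\<close>

definition H :: "real \<Rightarrow> 'd mat \<Rightarrow> ennreal" where
  "H y x = (1 + G x) * (\<integral>\<^sup>+ \<omega>. (if 2 \<le> N \<omega> then (1 + G (A 1 \<omega>)) *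
     (\<integral>\<^sup>+ z. (if opnorm x * l1norm (A 2 \<omega> *v z) \<le> c * y then 1 else 0) \<partial>\<mu>) else 0) \<partial>M)"

definition C :: ennreal where "C = ennreal (c powr a)"

lemma C_finite: "C < \<infinity>"
  by (simp add: C_def)

lemma W_measurable [measurable]: "W d \<in> borel_measurable borel"
  unfolding W_def by measurable

lemma H_measurable [measurable]: "H y \<in> borel_measurable borel"
  unfolding H_def by measurable

lemma h_finite: "0 < d \<Longrightarrow> h d < \<infinity>"
proof -
  assume d: "0 < d"
  have "h d \<le> (\<integral>\<^sup>+ z. npow a d \<partial>\<mu>)"
    unfolding h_def W_def using d a_pos by (intro nn_integral_mono npow_antimono) auto
  also have "\<dots> < \<infinity>" using npow_finite[OF d] by (simp add: mu.emeasure_space_1)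
  finally show ?thesis .
qed

text \<open>Two successive balanced comparisons, matrix with matrix and then matrix with vector,
  lose \<open>c * c\<close>; the loss of a single comparison is dominated by this.\<close>

definition C' :: ennreal where "C' = 1 + ennreal ((c * c) powr a)"

lemma C'_finite: "C' < \<infinity>" by (simp add: C'_def)

lemma C_le_C': "1 + C \<le> C'"
proof -
  have "c \<le> c * c" using c_ge by simp
  then have "c powr a \<le> (c * c) powr a" using c_ge a_pos by (intro powr_mono2) auto
  then show ?thesis by (auto simp: C_def C'_def intro!: add_left_mono ennreal_leI)
qed

lemma W_balanced_le:
  assumes "0 < d" "balanced c x" "\<And>i. 0 \<le> z $ i"
  shows "W d (x *v z) \<le> C' * (1 + G x) * W d z"
proof -
  have "W d (x *v z) \<le> (1 + npow a (opnorm x / c)) * W d z"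
    unfolding W_def using assms c_ge a_pos balanced_mv_ge[OF assms(2,3)]
    by (intro npow_max_le) (auto simp: field_simps)
  also have "\<dots> \<le> (1 + C) * (1 + G x) * W d z"
    unfolding C_def G_def using c_ge a_pos by (intro mult_right_mono one_plus_npow_le) auto
  also have "\<dots> \<le> C' * (1 + G x) * W d z"
    by (intro mult_right_mono C_le_C') auto
  finally show ?thesis .
qed

text \<open>All summands are nonnegative, so each is bounded in norm by the total. The first summand
  controls \<open>W d\<close> of the total; the second must be small when the total is at most
  \<open>y\<close>. As \<open>zs 1\<close> and \<open>zs 2\<close> are independent, the integral
  splits into \<open>h d\<close> times a probability.\<close>

lemma R_le:
  assumes d: "0 < d" and x: "balanced c x"
  shows "R (\<lambda>z. if l1norm z \<le> y then W d z else 0) x \<le> C' * h d * H y x"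
proof -
  define k where "k \<omega> z = (if opnorm x * l1norm (A 2 \<omega> *v z) \<le> c * y then 1 else 0 :: ennreal)" for \<omega> z
  have k_meas [measurable]: "k \<omega> \<in> borel_measurable borel" for \<omega>
    unfolding k_def by measurable
  have zs_nonneg: "AE zs in P. \<forall>n i. 0 \<le> zs n $ i"
    unfolding AE_all_countable
    by (intro allI AE_PiM_component mu.prob_space_axioms mu_nonneg[unfolded AE_all_countable, rule_format]) simp
  have *: "W d (x *v Y \<omega> zs) \<le> C' * (1 + G x) * (1 + G (A 1 \<omega>)) * W d (zs 1)"
       "opnorm x * l1norm (A 2 \<omega> *v zs 2) \<le> c * l1norm (x *v Y \<omega> zs)"
    if \<omega>: "2 \<le> N \<omega>" "balanced c (A 1 \<omega>)" "balanced c (x ** A 1 \<omega>)" "\<forall>i. nonneg_mat (A i \<omega>)"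
      and zs: "\<forall>n i. 0 \<le> zs n $ i" for \<omega> zs
  proof -
    \<comment> \<open>Dropping nonnegative summands can only decrease the l1 norm.\<close>
    have comp: "l1norm (x *v (A n \<omega> *v zs n)) \<le> l1norm (x *v Y \<omega> zs)" if "n \<in> {1..N \<omega>}" for n
    proof (rule l1norm_mono)
      have nn: "0 \<le> (x *v (A m \<omega> *v zs m)) $ i" for m i
        using \<omega> zs balancedD(1)[OF x] by (intro mv_nonneg) auto
      then show "0 \<le> (x *v (A n \<omega> *v zs n)) $ i" for i .
      show "(x *v (A n \<omega> *v zs n)) $ i \<le> (x *v Y \<omega> zs) $ i" for i
      proof -
        have "(x *v (A n \<omega> *v zs n)) $ i \<le> (\<Sum>m\<in>{1..N \<omega>}. (x *v (A m \<omega> *v zs m)) $ i)"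
          using that nn by (intro member_le_sum) auto
        also have "\<dots> = (x *v Y \<omega> zs) $ i"
          by (simp add: Y_def linear_sum[OF matrix_vector_mul_linear])
        finally show ?thesis .
      qed
    qed
    have "opnorm x * opnorm (A 1 \<omega>) * l1norm (zs 1) \<le> c * opnorm (x ** A 1 \<omega>) * l1norm (zs 1)"
      using balanced_opnorm_mult_ge[OF x] \<omega> c_ge by (intro mult_right_mono) auto
    also have "\<dots> \<le> c * (c * l1norm ((x ** A 1 \<omega>) *v zs 1))"
      using balanced_mv_ge[OF \<omega>(3)] zs c_ge by (simp add: mult.assoc mult_left_mono)
    also have "\<dots> \<le> c * (c * l1norm (x *v Y \<omega> zs))"
      using comp[of 1] \<omega>(1) c_ge by (simp add: matrix_vector_mul_assoc)
    finally have "opnorm x * opnorm (A 1 \<omega>) / (c * c) * l1norm (zs 1) \<le> l1norm (x *v Y \<omega> zs)"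
      using c_ge by (simp add: field_simps)
    then have "W d (x *v Y \<omega> zs) \<le> (1 + npow a (opnorm x * opnorm (A 1 \<omega>) / (c * c))) * W d (zs 1)"
      unfolding W_def using a_pos d c_ge by (intro npow_max_le) auto
    also have "\<dots> \<le> C' * (1 + npow a (opnorm x * opnorm (A 1 \<omega>))) * W d (zs 1)"
      unfolding C'_def using c_ge a_pos by (intro mult_right_mono one_plus_npow_le) auto
    also have "\<dots> = C' * (1 + G x * G (A 1 \<omega>)) * W d (zs 1)"
      by (simp add: npow_mult G_def)
    also have "\<dots> \<le> C' * ((1 + G x) * (1 + G (A 1 \<omega>))) * W d (zs 1)"
      by (intro mult_right_mono mult_left_mono)
         (auto simp: distrib_left distrib_right add.assoc intro!: add_left_mono add_increasing)
    finally show "W d (x *v Y \<omega> zs) \<le> C' * (1 + G x) * (1 + G (A 1 \<omega>)) * W d (zs 1)"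
      by (simp add: mult.assoc)
    have "opnorm x * l1norm (A 2 \<omega> *v zs 2) \<le> c * l1norm (x *v (A 2 \<omega> *v zs 2))"
      using \<omega> zs by (intro balanced_mv_ge x mv_nonneg) auto
    also have "\<dots> \<le> c * l1norm (x *v Y \<omega> zs)"
      using comp[of 2] \<omega>(1) c_ge by simp
    finally show "opnorm x * l1norm (A 2 \<omega> *v zs 2) \<le> c * l1norm (x *v Y \<omega> zs)" .
  qed
  have "R (\<lambda>z. if l1norm z \<le> y then W d z else 0) x \<le>
    (\<integral>\<^sup>+ \<omega>. (C' * h d * (1 + G x)) * (if 2 \<le> N \<omega> then (1 + G (A 1 \<omega>)) * (\<integral>\<^sup>+ z. k \<omega> z \<partial>\<mu>) else 0) \<partial>M)"
    unfolding R_def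
  proof (rule nn_integral_mono_AE, use A1_balanced A1_balanced_mult A_nonneg in eventually_elim)
    case (elim \<omega>)
    show ?case
    proof (cases "2 \<le> N \<omega>")
      case True
      have "(\<integral>\<^sup>+ zs. (if l1norm (x *v Y \<omega> zs) \<le> y then W d (x *v Y \<omega> zs) else 0) \<partial>P) \<le>
        (\<integral>\<^sup>+ zs. (C' * (1 + G x) * (1 + G (A 1 \<omega>))) * (W d (zs 1) * k \<omega> (zs 2)) \<partial>P)"
      proof (rule nn_integral_mono_AE, use zs_nonneg in eventually_elim)
        case z: (elim zs)
        show ?case
        proof (cases "l1norm (x *v Y \<omega> zs) \<le> y")
          case le: True
          then have "c * l1norm (x *v Y \<omega> zs) \<le> c * y" using c_ge by simp
          with *(2)[OF True _ _ _ z] elim x have "k \<omega> (zs 2) = 1" by (auto simp: k_def)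
          with *(1)[OF True _ _ _ z] elim x le show ?thesis by (simp add: mult.assoc)
        qed simp
      qed
      also have "\<dots> = (C' * (1 + G x) * (1 + G (A 1 \<omega>))) * (\<integral>\<^sup>+ zs. W d (zs 1) * k \<omega> (zs 2) \<partial>P)"
        by (rule nn_integral_cmult) measurable
      also have "(\<integral>\<^sup>+ zs. W d (zs 1) * k \<omega> (zs 2) \<partial>P) = h d * (\<integral>\<^sup>+ z. k \<omega> z \<partial>\<mu>)"
        unfolding h_def by (rule mu.nn_integral_PiM_nat_component2) measurable
      finally show ?thesis using True by (simp add: ac_simps)
    qed simp
  qed
  also have "\<dots> = (C' * h d * (1 + G x)) * (\<integral>\<^sup>+ \<omega>. (if 2 \<le> N \<omega> then (1 + G (A 1 \<omega>)) * (\<integral>\<^sup>+ z. k \<omega> z \<partial>\<mu>) else 0) \<partial>M)"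
    unfolding k_def by (rule nn_integral_cmult) measurable
  finally show ?thesis unfolding H_def k_def by (simp only: mult.assoc)
qed

lemma T_funpow_1: "(T ^^ n) (\<lambda>_. 1) x = emeasure M {\<omega> \<in> space M. N \<omega> = 1} ^ n"
proof (induction n arbitrary: x)
  case (Suc n)
  let ?S = "{\<omega> \<in> space M. N \<omega> = 1}"
  have "(T ^^ Suc n) (\<lambda>_. 1) x = (\<integral>\<^sup>+ \<omega>. emeasure M ?S ^ n * indicator ?S \<omega> \<partial>M)"
    unfolding funpow.simps comp_def T_def[of "(T ^^ n) _"] Suc
    by (intro nn_integral_cong) auto
  then show ?case
    by (subst (asm) nn_integral_cmult_indicator) (auto simp: mult.commute)
qed simp

lemma p_less_1: "emeasure M {\<omega> \<in> space M. N \<omega> = 1} < 1"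
proof (rule ccontr)
  assume "\<not> ?thesis"
  then have "emeasure M {\<omega> \<in> space M. N \<omega> = 1} = 1"
    using M.emeasure_le_1 by (metis order_le_less)
  then have "M.prob {\<omega> \<in> space M. N \<omega> = 1} = 1"
    by (simp add: M.emeasure_eq_measure)
  then have "AE \<omega> in M. N \<omega> = 1"
    by (subst (asm) M.prob_Collect_eq_1) auto
  with N_branching show False ..
qed

lemma G_A1_integral: "(\<integral>\<^sup>+ \<omega>. G (A 1 \<omega>) \<partial>M) < \<infinity>"
  using A1_moment by (simp add: G_def)

text \<open>Dominated convergence for one step of \<open>T\<close>. The second conclusion reproduces
  the domination with a new constant, so that the step can be iterated.\<close>

lemma T_tendsto_0:
  assumes g_meas [measurable]: "\<And>m. g m \<in> borel_measurable borel"
    and g_lim: "\<And>x. balanced c x \<Longrightarrow> (\<lambda>m. g m x) \<longlonglongrightarrow> 0"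
    and g_le: "\<And>m x. balanced c x \<Longrightarrow> g m x \<le> B * (1 + G x)"
    and B: "B < \<infinity>"
  shows "balanced c x \<Longrightarrow> (\<lambda>m. T (g m) x) \<longlonglongrightarrow> 0"
    and "\<exists>B'<\<infinity>. \<forall>m x. balanced c x \<longrightarrow> T (g m) x \<le> B' * (1 + G x)"
proof -
  let ?E = "\<integral>\<^sup>+ \<omega>. G (A 1 \<omega>) \<partial>M"
  \<comment> \<open>The majorant comes from
    \<open>G (x ** A 1 \<omega>) \<le> C * (G x * G (A 1 \<omega>))\<close> and is integrable by the
    moment assumption on \<open>A 1\<close>.\<close>
  define V where "V x \<omega> = B * (1 + C * (G x * G (A 1 \<omega>)))" for x \<omega>
  have [measurable]: "V x \<in> borel_measurable M" for x
    unfolding V_def by measurable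
  have V: "AE \<omega> in M. \<forall>m. (if N \<omega> = 1 then g m (x ** A 1 \<omega>) else 0) \<le> V x \<omega>"
    if x: "balanced c x" for x
    using A1_balanced_mult A_nonneg
  proof eventually_elim
    case (elim \<omega>)
    then have "g m (x ** A 1 \<omega>) \<le> B * (1 + G (x ** A 1 \<omega>))" for m
      using x by (intro g_le) auto
    moreover have "B * (1 + G (x ** A 1 \<omega>)) \<le> V x \<omega>"
      unfolding V_def C_def using elim x by (intro mult_left_mono add_left_mono G_mult_le) auto
    ultimately show ?case by (auto intro: order_trans)
  qed
  have V_int: "(\<integral>\<^sup>+ \<omega>. V x \<omega> \<partial>M) = B * (1 + C * (G x * ?E))" for x
    unfolding V_def
    by (simp add: nn_integral_cmult nn_integral_add M.emeasure_space_1)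
  {
    assume x: "balanced c x"
    have "(\<lambda>m. T (g m) x) \<longlonglongrightarrow> (\<integral>\<^sup>+ \<omega>. 0 \<partial>M)"
      unfolding T_def
    proof (rule nn_integral_dominated_convergence[where w = "V x"])
      show "AE \<omega> in M. (if N \<omega> = 1 then g m (x ** A 1 \<omega>) else 0) \<le> V x \<omega>" for m
        using V[OF x] by eventually_elim auto
      show "(\<integral>\<^sup>+ \<omega>. V x \<omega> \<partial>M) < \<infinity>"
        unfolding V_int using B C_finite G_finite[OF x] G_A1_integral
        by (simp add: ennreal_mult_less_top)
      show "AE \<omega> in M. (\<lambda>m. if N \<omega> = 1 then g m (x ** A 1 \<omega>) else 0) \<longlonglongrightarrow> 0"
        using A1_balanced_mult
      proof eventually_elim
        case (elim \<omega>)
        then have "(\<lambda>m. g m (x ** A 1 \<omega>)) \<longlonglongrightarrow> 0" using g_lim x by blast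
        then show ?case by (cases "N \<omega> = 1") auto
      qed
    qed measurable
    then show "(\<lambda>m. T (g m) x) \<longlonglongrightarrow> 0" by simp
  }
  show "\<exists>B'<\<infinity>. \<forall>m x. balanced c x \<longrightarrow> T (g m) x \<le> B' * (1 + G x)"
  proof (intro exI conjI allI impI)
    show "B * (1 + C * ?E) < \<infinity>"
      using B C_finite G_A1_integral by (simp add: ennreal_mult_less_top)
    fix m and x :: "'d mat" assume x: "balanced c x"
    have "T (g m) x \<le> (\<integral>\<^sup>+ \<omega>. V x \<omega> \<partial>M)"
      unfolding T_def by (rule nn_integral_mono_AE) (use V[OF x] in eventually_elim, auto)
    also have "\<dots> \<le> B * ((1 + C * ?E) * (1 + G x))"
      unfolding V_int
      by (intro mult_left_mono)
         (auto simp: distrib_left distrib_right ac_simps intro!: add_left_mono add_increasing)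
    finally show "T (g m) x \<le> B * (1 + C * ?E) * (1 + G x)"
      by (simp add: mult.assoc)
  qed
qed

lemma H_le: "H y x \<le> (1 + (\<integral>\<^sup>+ \<omega>. G (A 1 \<omega>) \<partial>M)) * (1 + G x)"
proof -
  have "(\<integral>\<^sup>+ z. (if opnorm x * l1norm (A 2 \<omega> *v z) \<le> c * y then 1 else 0) \<partial>\<mu>) \<le> (\<integral>\<^sup>+ z. 1 \<partial>\<mu>)" for \<omega>
    by (intro nn_integral_mono) auto
  then have "(\<integral>\<^sup>+ z. (if opnorm x * l1norm (A 2 \<omega> *v z) \<le> c * y then 1 else 0) \<partial>\<mu>) \<le> 1" for \<omega>
    by (simp add: mu.emeasure_space_1)
  then have "H y x \<le> (1 + G x) * (\<integral>\<^sup>+ \<omega>. (1 + G (A 1 \<omega>)) * 1 \<partial>M)"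
    unfolding H_def
    by (intro mult_left_mono nn_integral_mono) (auto simp del: mult_1_right intro!: mult_left_mono)
  also have "(\<integral>\<^sup>+ \<omega>. (1 + G (A 1 \<omega>)) * 1 \<partial>M) = 1 + (\<integral>\<^sup>+ \<omega>. G (A 1 \<omega>) \<partial>M)"
    by (simp add: nn_integral_add M.emeasure_space_1)
  finally show ?thesis by (simp add: mult.commute)
qed

text \<open>For fixed \<open>\<omega>\<close> with \<open>A 2 \<omega>\<close> nonzero,
  \<open>A 2 \<omega> *v z\<close> is almost surely nonzero, so the smallness condition eventually
  fails as the threshold shrinks. Dominated convergence is applied first in \<open>z\<close> and
  then in \<open>\<omega>\<close>.\<close>

lemma H_tendsto_0:
  assumes x: "balanced c x"
  shows "(\<lambda>m. H (inverse (Suc m)) x) \<longlonglongrightarrow> 0"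
proof -
  let ?k = "\<lambda>m \<omega> z. (if opnorm x * l1norm (A 2 \<omega> *v z) \<le> c * inverse (real (Suc m)) then 1 else 0 :: ennreal)"
  have y0: "(\<lambda>m. c * inverse (real (Suc m))) \<longlonglongrightarrow> 0"
    by (intro tendsto_mult_right_zero LIMSEQ_inverse_real_of_nat)
  have k_lim: "(\<lambda>m. \<integral>\<^sup>+ z. ?k m \<omega> z \<partial>\<mu>) \<longlonglongrightarrow> 0"
    if \<omega>: "A 2 \<omega> \<noteq> 0" "nonneg_mat (A 2 \<omega>)" for \<omega>
  proof -
    have "(\<lambda>m. \<integral>\<^sup>+ z. ?k m \<omega> z \<partial>\<mu>) \<longlonglongrightarrow> (\<integral>\<^sup>+ z. 0 \<partial>\<mu>)"
    proof (rule nn_integral_dominated_convergence[where w = "\<lambda>_. 1"])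
      show "AE z in \<mu>. (\<lambda>m. ?k m \<omega> z) \<longlonglongrightarrow> 0"
        using mu_positive
      proof eventually_elim
        case (elim z)
        obtain i j where "A 2 \<omega> $ i $ j \<noteq> 0" using \<omega>(1) by (auto simp: vec_eq_iff)
        then have "0 < A 2 \<omega> $ i $ j" using \<omega>(2) by (auto simp: nonneg_mat_def order_le_less)
        then have "0 < (A 2 \<omega> *v z) $ i"
          using elim \<omega>(2) by (intro mv_pos[where j = j]) (auto intro: less_imp_le)
        then have "A 2 \<omega> *v z \<noteq> 0" by auto
        then have "0 < opnorm x * l1norm (A 2 \<omega> *v z)"
          using balanced_opnorm_pos[OF x] by (simp add: l1norm_pos_iff)
        from order_tendstoD(2)[OF y0 this] show ?case
          by (intro tendsto_eventually) (auto elim!: eventually_mono)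
      qed
    qed (auto simp: mu.emeasure_space_1)
    then show ?thesis by simp
  qed
  have "(\<lambda>m. \<integral>\<^sup>+ \<omega>. (if 2 \<le> N \<omega> then (1 + G (A 1 \<omega>)) * (\<integral>\<^sup>+ z. ?k m \<omega> z \<partial>\<mu>) else 0) \<partial>M)
    \<longlonglongrightarrow> (\<integral>\<^sup>+ \<omega>. 0 \<partial>M)"
  proof (rule nn_integral_dominated_convergence[where w = "\<lambda>\<omega>. 1 + G (A 1 \<omega>)"])
    show "AE \<omega> in M. (if 2 \<le> N \<omega> then (1 + G (A 1 \<omega>)) * (\<integral>\<^sup>+ z. ?k m \<omega> z \<partial>\<mu>) else 0) \<le> 1 + G (A 1 \<omega>)" for m
    proof (rule AE_I2)
      fix \<omega>
      have "(\<integral>\<^sup>+ z. ?k m \<omega> z \<partial>\<mu>) \<le> (\<integral>\<^sup>+ z. 1 \<partial>\<mu>)"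
        by (intro nn_integral_mono) auto
      then have "(1 + G (A 1 \<omega>)) * (\<integral>\<^sup>+ z. ?k m \<omega> z \<partial>\<mu>) \<le> (1 + G (A 1 \<omega>)) * 1"
        by (intro mult_left_mono) (auto simp: mu.emeasure_space_1)
      then show "(if 2 \<le> N \<omega> then (1 + G (A 1 \<omega>)) * (\<integral>\<^sup>+ z. ?k m \<omega> z \<partial>\<mu>) else 0) \<le> 1 + G (A 1 \<omega>)"
        by simp
    qed
    show "(\<integral>\<^sup>+ \<omega>. 1 + G (A 1 \<omega>) \<partial>M) < \<infinity>"
      using G_A1_integral by (simp add: nn_integral_add M.emeasure_space_1)
    show "AE \<omega> in M. (\<lambda>m. if 2 \<le> N \<omega> then (1 + G (A 1 \<omega>)) * (\<integral>\<^sup>+ z. ?k m \<omega> z \<partial>\<mu>) else 0) \<longlonglongrightarrow> 0"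
      using A1_balanced A2_nonzero A_nonneg
    proof eventually_elim
      case (elim \<omega>)
      show ?case
      proof (cases "2 \<le> N \<omega>")
        case True
        have "(\<lambda>m. (1 + G (A 1 \<omega>)) * (\<integral>\<^sup>+ z. ?k m \<omega> z \<partial>\<mu>)) \<longlonglongrightarrow> (1 + G (A 1 \<omega>)) * 0"
          using elim True G_finite[OF elim(1)] by (intro ennreal_tendsto_cmult k_lim) (auto simp: less_top)
        then show ?thesis by (simp only: True if_True mult_zero_right)
      qed simp
    qed
  qed measurable
  then have "(\<lambda>m. H (inverse (Suc m)) x) \<longlonglongrightarrow> (1 + G x) * (\<integral>\<^sup>+ \<omega>. 0 \<partial>M)"
    unfolding H_def using G_finite[OF x] by (intro ennreal_tendsto_cmult) (auto simp: less_top)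
  then show ?thesis by simp
qed

lemma T_funpow_H_tendsto_0:
  assumes "balanced c x"
  shows "(\<lambda>m. (T ^^ k) (H (inverse (Suc m))) x) \<longlonglongrightarrow> 0"
proof -
  have "(\<forall>x. balanced c x \<longrightarrow> (\<lambda>m. (T ^^ k) (H (inverse (Suc m))) x) \<longlonglongrightarrow> 0) \<and>
    (\<exists>B<\<infinity>. \<forall>m x. balanced c x \<longrightarrow> (T ^^ k) (H (inverse (Suc m))) x \<le> B * (1 + G x))"
  proof (induction k)
    case 0
    have "1 + (\<integral>\<^sup>+ \<omega>. G (A 1 \<omega>) \<partial>M) < \<infinity>" using G_A1_integral by simp
    moreover have "H (inverse (Suc m)) x \<le> (1 + (\<integral>\<^sup>+ \<omega>. G (A 1 \<omega>) \<partial>M)) * (1 + G x)" for m x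
      by (rule H_le)
    ultimately show ?case using H_tendsto_0 unfolding funpow_0 by blast
  next
    case (Suc k)
    then obtain B where B: "B < \<infinity>"
      "\<And>m x. balanced c x \<Longrightarrow> (T ^^ k) (H (inverse (Suc m))) x \<le> B * (1 + G x)" by blast
    from Suc have "\<And>x. balanced c x \<Longrightarrow> (\<lambda>m. (T ^^ k) (H (inverse (Suc m))) x) \<longlonglongrightarrow> 0" by blast
    from T_tendsto_0[OF _ this B(2,1)] show ?case by simp
  qed
  with assms show ?thesis by blast
qed

lemma D_truncated_le:
  assumes d: "0 < d" and x: "balanced c x"
  shows "D (\<lambda>z. if l1norm z \<le> y then W d z else 0) x \<le> C' * h d * (1 + G x)"
proof -
  have "D (\<lambda>z. if l1norm z \<le> y then W d z else 0) x \<le> (\<integral>\<^sup>+ z. C' * (1 + G x) * W d z \<partial>\<mu>)"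
    unfolding D_def
  proof (rule nn_integral_mono_AE, use mu_nonneg in eventually_elim)
    case (elim z)
    with W_balanced_le[OF d x, of z] show ?case by auto
  qed
  also have "\<dots> = C' * h d * (1 + G x)"
    unfolding h_def by (subst nn_integral_cmult) (auto simp: ac_simps)
  finally show ?thesis .
qed

text \<open>Where \<open>l1norm z\<close> exceeds \<open>y\<close> the weight is at most
  \<open>npow a y\<close>. The remaining part is expanded over \<open>n\<close> steps, and every
  resulting term carries the factor \<open>h d\<close>.\<close>

lemma h_le:
  assumes d: "0 < d" and y: "0 < y"
  shows "h d \<le> npow a y + h d * (C' * ((T ^^ n) (\<lambda>_. 1) (mat 1) + u n) +
    C' * (\<Sum>k<n. (T ^^ k) (H y) (mat 1)))"
proof -
  let ?f = "\<lambda>z. if l1norm z \<le> y then W d z else 0"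
  have "h d \<le> (\<integral>\<^sup>+ z. npow a y + ?f z \<partial>\<mu>)"
    unfolding h_def
  proof (rule nn_integral_mono)
    fix z
    have "W d z \<le> npow a y" if "\<not> l1norm z \<le> y"
      unfolding W_def using that y a_pos by (intro npow_antimono) auto
    then show "W d z \<le> npow a y + ?f z" by auto
  qed
  also have "\<dots> = npow a y + D ?f (mat 1)"
    unfolding D_def matrix_vector_mul_lid by (subst nn_integral_add) (auto simp: mu.emeasure_space_1)
  also have "D ?f (mat 1) = (T ^^ n) (D ?f) (mat 1) + (\<Sum>k<n. (T ^^ k) (R ?f) (mat 1))"
    by (rule D_expand) measurable
  also have "\<dots> \<le> (T ^^ n) (\<lambda>x. C' * h d * (1 + G x)) (mat 1) +
      (\<Sum>k<n. (T ^^ k) (\<lambda>x. C' * h d * H y x) (mat 1))"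
    using d by (intro add_mono sum_mono T_funpow_mono_balanced D_truncated_le R_le) auto
  also have "\<dots> = h d * (C' * ((T ^^ n) (\<lambda>_. 1) (mat 1) + u n) +
    C' * (\<Sum>k<n. (T ^^ k) (H y) (mat 1)))"
  proof -
    have "(T ^^ n) (\<lambda>x. C' * h d * (1 + G x)) (mat 1) = C' * h d * ((T ^^ n) (\<lambda>_. 1) (mat 1) + u n)"
      unfolding u_def by (subst T_funpow_cmult) (simp_all add: T_funpow_add)
    moreover have "(T ^^ k) (\<lambda>x. C' * h d * H y x) (mat 1) = C' * h d * (T ^^ k) (H y) (mat 1)" for k
      by (rule T_funpow_cmult) measurable
    ultimately show ?thesis
      by (simp add: distrib_left ac_simps flip: sum_distrib_left)
  qed
  finally show ?thesis by (simp add: add_left_mono)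
qed

lemma moment_if_u_tendsto_0:
  assumes "(\<lambda>n. enn2real (u n)) \<longlonglongrightarrow> 0"
  shows "(\<integral>\<^sup>+ z. F z \<partial>\<mu>) < \<infinity>"
proof -
  have "(\<lambda>n. ennreal (enn2real (u n))) \<longlonglongrightarrow> ennreal 0"
    using assms by (rule tendsto_ennrealI)
  then have u_lim: "u \<longlonglongrightarrow> 0"
    using u_finite by simp
  have "(\<lambda>n. ennreal (M.prob {\<omega> \<in> space M. N \<omega> = 1} ^ n)) \<longlonglongrightarrow> ennreal 0"
    using p_less_1 by (intro tendsto_ennrealI LIMSEQ_realpow_zero) (auto simp: M.emeasure_eq_measure)
  then have "(\<lambda>n. (T ^^ n) (\<lambda>_. 1) (mat 1)) \<longlonglongrightarrow> 0"
    by (simp add: T_funpow_1 M.emeasure_eq_measure ennreal_power)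
  then have "(\<lambda>n. C' * ((T ^^ n) (\<lambda>_. 1) (mat 1) + u n)) \<longlonglongrightarrow> C' * (0 + 0)"
    using C'_finite u_lim by (intro ennreal_tendsto_cmult tendsto_add) auto
  \<comment> \<open>First \<open>n\<close> is fixed to make the term without branching small; only
    then is \<open>y\<close> chosen, for the finitely many branching terms. The two quarters leave
    half of \<open>h d\<close> to absorb.\<close>
  then have "eventually (\<lambda>n. C' * ((T ^^ n) (\<lambda>_. 1) (mat 1) + u n) < ennreal (1 / 4)) sequentially"
    by (intro order_tendstoD(2)) auto
  then obtain n where n: "C' * ((T ^^ n) (\<lambda>_. 1) (mat 1) + u n) < ennreal (1 / 4)"
    by (auto simp: eventually_sequentially)
  have "(\<lambda>m. C' * (\<Sum>k<n. (T ^^ k) (H (inverse (Suc m))) (mat 1))) \<longlonglongrightarrow> C' * (\<Sum>k<n. 0)"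
    using C'_finite by (intro ennreal_tendsto_cmult tendsto_sum T_funpow_H_tendsto_0) auto
  then have "eventually (\<lambda>m. C' * (\<Sum>k<n. (T ^^ k) (H (inverse (Suc m))) (mat 1)) < ennreal (1 / 4)) sequentially"
    by (intro order_tendstoD(2)) auto
  then obtain m where m: "C' * (\<Sum>k<n. (T ^^ k) (H (inverse (Suc m))) (mat 1)) < ennreal (1 / 4)"
    by (auto simp: eventually_sequentially)
  define y where "y = inverse (real (Suc m))"
  have y: "0 < y" by (simp add: y_def)
  \<comment> \<open>Since \<open>h d\<close> is finite, \<open>h d \<le> npow a y + h d / 2\<close>
    gives a bound in which \<open>d\<close> no longer appears.\<close>
  have h_bound: "h d \<le> ennreal (2 * y powr (- a))" if d: "0 < d" for d
  proof -
    obtain r where r: "0 \<le> r" "h d = ennreal r"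
      using h_finite[OF d] by (metis ennreal_cases infinity_ennreal_def less_irrefl)
    have "h d \<le> npow a y + h d * (ennreal (1 / 4) + ennreal (1 / 4))"
      by (rule order_trans[OF h_le[OF d y, of n]])
         (intro add_left_mono mult_left_mono add_mono, use n m in \<open>auto simp: y_def\<close>)
    also have "ennreal (1 / 4) + ennreal (1 / 4) = ennreal (1 / 2)"
      by (simp flip: ennreal_plus)
    also have "npow a y + h d * ennreal (1 / 2) = ennreal (y powr (- a) + r * (1 / 2))"
      unfolding r npow_eq_powr[OF y] using r(1) by (simp only: ennreal_mult[symmetric] ennreal_plus[symmetric] powr_ge_zero)
    finally have "r \<le> y powr (- a) + r * (1 / 2)"
      unfolding r using r(1) by (subst (asm) ennreal_le_iff) (auto intro!: add_nonneg_nonneg)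
    then show ?thesis unfolding r by (intro ennreal_leI) simp
  qed
  \<comment> \<open>The cutoff is removed by Fatou's lemma: for nonzero \<open>z\<close>,
    \<open>W d z\<close> equals \<open>F z\<close> once \<open>d\<close> is below
    \<open>l1norm z\<close>.\<close>
  have "(\<integral>\<^sup>+ z. F z \<partial>\<mu>) = (\<integral>\<^sup>+ z. liminf (\<lambda>m. W (inverse (Suc m)) z) \<partial>\<mu>)"
  proof (rule nn_integral_cong_AE, use mu_nonzero in eventually_elim)
    case (elim z)
    then have "0 < l1norm z" by (simp add: l1norm_pos_iff)
    with LIMSEQ_inverse_real_of_nat have "eventually (\<lambda>m. inverse (Suc m) < l1norm z) sequentially"
      by (rule order_tendstoD(2))
    then have "eventually (\<lambda>m. W (inverse (Suc m)) z = F z) sequentially"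
      by eventually_elim (simp add: W_def F_def max_def)
    then have "(\<lambda>m. W (inverse (Suc m)) z) \<longlonglongrightarrow> F z"
      by (rule tendsto_eventually)
    then show ?case by (subst lim_imp_Liminf) auto
  qed
  also have "\<dots> \<le> liminf (\<lambda>m. \<integral>\<^sup>+ z. W (inverse (Suc m)) z \<partial>\<mu>)"
    by (rule nn_integral_liminf) measurable
  also have "\<dots> \<le> ennreal (2 * y powr (- a))"
    by (rule Liminf_le) (auto intro!: h_bound[unfolded h_def] always_eventually)
  finally show ?thesis by (simp add: le_less_trans)
qed

section \<open>Identification of \<open>\<kappa>\<close>\<close>

abbreviation p :: real where
  "p \<equiv> M.prob {\<omega> \<in> space M. N \<omega> = 1}"

abbreviation L :: "'d mat measure" where
  "L \<equiv> cond_law M N A"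

lemma L_sets [measurable_cong]: "sets L = sets borel"
  by (simp add: cond_law_def Let_def)

text \<open>The factor \<open>p\<close> cancels the normalization of the conditional law.\<close>

lemma T_eq_L:
  assumes p: "0 < p" and g [measurable]: "g \<in> borel_measurable borel"
  shows "T g x = ennreal p * (\<integral>\<^sup>+ b. g (x ** b) \<partial>L)"
proof -
  let ?S = "{\<omega> \<in> space M. N \<omega> = 1}"
  have "ennreal p * (\<integral>\<^sup>+ b. g (x ** b) \<partial>L) =
    ennreal p * (\<integral>\<^sup>+ \<omega>. indicator ?S \<omega> / emeasure M ?S * g (x ** A 1 \<omega>) \<partial>M)"
    unfolding cond_law_def Let_def
    by (subst nn_integral_distr, simp, simp, subst nn_integral_density) simp_all
  also have "\<dots> = (\<integral>\<^sup>+ \<omega>. ennreal p * (indicator ?S \<omega> / emeasure M ?S * g (x ** A 1 \<omega>)) \<partial>M)"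
    by (rule nn_integral_cmult[symmetric]) measurable
  also have "\<dots> = T g x"
    unfolding T_def
  proof (rule nn_integral_cong)
    fix \<omega> assume "\<omega> \<in> space M"
    have "ennreal p * (1 / ennreal p) = 1"
      using p by (simp add: ennreal_1[symmetric] divide_ennreal ennreal_mult[symmetric] del: ennreal_1)
    then show "ennreal p * (indicator ?S \<omega> / emeasure M ?S * g (x ** A 1 \<omega>)) =
      (if N \<omega> = 1 then g (x ** A 1 \<omega>) else 0)"
      using \<open>\<omega> \<in> space M\<close> unfolding M.emeasure_eq_measure
      by (cases "N \<omega> = 1") (simp_all add: mult.assoc[symmetric])
  qed
  finally show ?thesis ..
qed

lemma L_prob_space: "0 < p \<Longrightarrow> prob_space L"
proof
  assume p: "0 < p"
  have "ennreal p * emeasure L (space L) = T (\<lambda>_. 1) (mat 1)"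
    using T_eq_L[OF p, of "\<lambda>_. 1"] by simp
  also have "\<dots> = ennreal p * 1"
    using T_funpow_1[of 1] by (simp add: M.emeasure_eq_measure)
  finally show "emeasure L (space L) = 1"
    by (rule ennreal_mult_cancel_left[THEN iffD1, THEN disjE]) (use p in auto)
qed

text \<open>The outermost step of \<open>T\<close> supplies the leftmost factor, which
  \<open>mprod\<close> reads from its last coordinate. That coordinate is integrated in the outer
  integral and moved into \<open>x\<close>, hence the induction over arbitrary
  \<open>x\<close>.\<close>

lemma T_funpow_eq_PiM:
  assumes p: "0 < p"
  shows "(T ^^ n) G x = ennreal p ^ n * (\<integral>\<^sup>+ B. G (x ** mprod B n) \<partial>PiM {..<n} (\<lambda>_. L))"
proof (induction n arbitrary: x)
  case 0
  then show ?case by (simp add: PiM_empty nn_integral_count_space_finite)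
next
  case (Suc n)
  interpret L: prob_space L by (rule L_prob_space[OF p])
  interpret LP: product_sigma_finite "\<lambda>_::nat. L" ..
  have meas [measurable]: "(\<lambda>B. mprod B n) \<in> borel_measurable (PiM {..<n} (\<lambda>_. L))" for n
    by (rule mprod_measurable[OF L_sets]) simp
  have "(\<integral>\<^sup>+ B. G (x ** mprod B (Suc n)) \<partial>PiM {..<Suc n} (\<lambda>_. L)) =
    (\<integral>\<^sup>+ b. (\<integral>\<^sup>+ B. G (x ** mprod (B(n := b)) (Suc n)) \<partial>PiM {..<n} (\<lambda>_. L)) \<partial>L)"
    unfolding lessThan_Suc
    by (rule LP.product_nn_integral_insert_rev) (use meas[of "Suc n"] in \<open>auto simp: lessThan_Suc\<close>)
  also have "\<dots> = (\<integral>\<^sup>+ b. (\<integral>\<^sup>+ B. G ((x ** b) ** mprod B n) \<partial>PiM {..<n} (\<lambda>_. L)) \<partial>L)"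
  proof -
    have "mprod (B(n := b)) n = mprod B n" for B :: "nat \<Rightarrow> 'd mat" and b
      by (rule mprod_cong) simp
    then show ?thesis by (simp add: matrix_mul_assoc)
  qed
  finally have *: "(\<integral>\<^sup>+ B. G (x ** mprod B (Suc n)) \<partial>PiM {..<Suc n} (\<lambda>_. L)) =
    (\<integral>\<^sup>+ b. (\<integral>\<^sup>+ B. G ((x ** b) ** mprod B n) \<partial>PiM {..<n} (\<lambda>_. L)) \<partial>L)" .
  interpret LPn: prob_space "PiM {..<n} (\<lambda>_. L)"
    by (rule prob_space_PiM) (rule L.prob_space_axioms)
  have "(T ^^ Suc n) G x = ennreal p * (\<integral>\<^sup>+ b. (T ^^ n) G (x ** b) \<partial>L)"
    by (simp add: T_eq_L[OF p])
  also have "(\<integral>\<^sup>+ b. (T ^^ n) G (x ** b) \<partial>L) =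
    (\<integral>\<^sup>+ b. ennreal p ^ n * (\<integral>\<^sup>+ B. G ((x ** b) ** mprod B n) \<partial>PiM {..<n} (\<lambda>_. L)) \<partial>L)"
    by (simp only: Suc)
  also have "\<dots> = ennreal p ^ n * (\<integral>\<^sup>+ B. G (x ** mprod B (Suc n)) \<partial>PiM {..<Suc n} (\<lambda>_. L))"
    unfolding * by (rule nn_integral_cmult) measurable
  finally show ?case by (simp add: mult.assoc)
qed

text \<open>At norm 0 \<open>npow\<close> is infinite but \<open>powr\<close> is 0. Finiteness of
  \<open>u n\<close> and \<open>0 < p\<close> exclude this case almost everywhere, so the two
  integrals agree.\<close>

lemma u_eq_PiM:
  assumes p: "0 < p"
  shows "enn2real (u n) = p ^ n * (\<integral>B. opnorm (mprod B n) powr (- a) \<partial>PiM {..<n} (\<lambda>_. L))"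
proof -
  let ?Q = "PiM {..<n} (\<lambda>_. L)"
  have meas [measurable]: "(\<lambda>B. mprod B n) \<in> borel_measurable ?Q"
    by (rule mprod_measurable[OF L_sets]) simp
  have u: "u n = ennreal p ^ n * (\<integral>\<^sup>+ B. G (mprod B n) \<partial>?Q)"
    unfolding u_def T_funpow_eq_PiM[OF p] by simp
  have "(\<integral>\<^sup>+ B. G (mprod B n) \<partial>?Q) \<noteq> \<infinity>"
  proof
    assume "(\<integral>\<^sup>+ B. G (mprod B n) \<partial>?Q) = \<infinity>"
    with u p have "u n = \<infinity>" by (simp add: ennreal_mult_top ennreal_power)
    with u_finite[of n] show False by simp
  qed
  then have "AE B in ?Q. G (mprod B n) \<noteq> \<infinity>"
    by (intro nn_integral_PInf_AE) auto
  then have "AE B in ?Q. G (mprod B n) = ennreal (opnorm (mprod B n) powr (- a))"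
  proof eventually_elim
    case (elim B)
    then have "opnorm (mprod B n) \<noteq> 0" by (auto simp: G_def npow_def)
    then have "0 < opnorm (mprod B n)" using opnorm_nonneg[of "mprod B n"] by linarith
    then show ?case by (simp add: G_def npow_eq_powr)
  qed
  then have "(\<integral>\<^sup>+ B. G (mprod B n) \<partial>?Q) = (\<integral>\<^sup>+ B. ennreal (opnorm (mprod B n) powr (- a)) \<partial>?Q)"
    by (rule nn_integral_cong_AE)
  then show ?thesis
    unfolding u by (simp add: enn2real_mult integral_eq_nn_integral ennreal_power)
qed

lemma u_pos:
  assumes p: "0 < p" shows "0 < u n"
proof -
  have "u 1 \<noteq> 0"
  proof
    assume "u 1 = 0"
    then have "AE \<omega> in M. (if N \<omega> = 1 then G (mat 1 ** A 1 \<omega>) else 0) = 0"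
      unfolding u_def T_def by (simp add: nn_integral_0_iff_AE)
    then have "AE \<omega> in M. \<not> N \<omega> = 1"
      by eventually_elim (auto simp: G_def npow_def split: if_splits)
    then have "p = 0"
      by (subst M.prob_eq_0) auto
    with p show False by simp
  qed
  then have "0 < u 1" by (simp add: zero_less_iff_neq_zero)
  then show ?thesis
  proof (induction n)
    case (Suc n)
    then have "0 < u 1 * u n" by (simp add: ennreal_zero_less_mult_iff)
    then show ?case using u_add_ge[of 1 n] by (simp add: less_le_trans)
  qed simp
qed

text \<open>Since \<open>u n\<close> is \<open>p ^ n\<close> times the moment of the product, its
  \<open>n\<close>-th root is \<open>p\<close> times the root defining \<open>kappa_tilde\<close>;
  hence \<open>l\<close> is \<open>kappa_tilde M N A (- a) * p\<close>.\<close>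

lemma kappa_less_1_iff:
  assumes p: "0 < p"
  shows "kappa_tilde M N A (- a) * p < 1 \<longleftrightarrow> (\<lambda>n. enn2real (u n)) \<longlonglongrightarrow> 0"
proof -
  define v where "v n = enn2real (u n)" for n
  have u: "u n = ennreal (v n)" for n
    using u_finite[of n] by (simp add: v_def)
  have v_pos: "0 < v n" for n
    using u_pos[OF p, of n] unfolding u by simp
  have v_ge: "v m * v n \<le> v (m + n)" for m n
    using u_add_ge[of m n] v_pos less_imp_le[OF v_pos] unfolding u by (simp flip: ennreal_mult)
  have v_le: "v (m + n) \<le> c powr a * (v m * v n)" for m n
    using u_add_le[of m n] v_pos less_imp_le[OF v_pos] unfolding u by (simp flip: ennreal_mult)
  obtain l where l: "(\<lambda>n. v n powr (1 / real n)) \<longlonglongrightarrow> l" "l < 1 \<longleftrightarrow> v \<longlonglongrightarrow> 0"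
    using quasi_multiplicative_root_limit[of v "c powr a"] v_pos v_ge v_le c_ge a_pos
    by (metis ge_one_powr_ge_zero less_imp_le)
  let ?w = "\<lambda>n. \<integral>B. opnorm (mprod B n) powr (- a) \<partial>PiM {..<n} (\<lambda>_. L)"
  have "(\<lambda>n. v n powr (1 / real n) / p) \<longlonglongrightarrow> l / p"
    using l(1) p by (intro tendsto_divide) auto
  moreover have "eventually (\<lambda>n. v n powr (1 / real n) / p = ?w n powr (1 / real n)) sequentially"
    using eventually_gt_at_top[of "0::nat"]
  proof eventually_elim
    case (elim n)
    have "0 \<le> ?w n" by (intro integral_nonneg_AE) auto
    then have "v n powr (1 / n) = (p ^ n) powr (1 / n) * ?w n powr (1 / n)"
      using p unfolding v_def u_eq_PiM[OF p] by (simp add: powr_mult)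
    also have "(p ^ n) powr (1 / n) = p"
      using p elim by (simp add: powr_powr flip: powr_realpow)
    finally show ?case using p by simp
  qed
  ultimately have "(\<lambda>n. ?w n powr (1 / real n)) \<longlonglongrightarrow> l / p"
    by (rule Lim_transform_eventually)
  then have "kappa_tilde M N A (- a) = l / p"
    unfolding kappa_tilde_def by (rule limI)
  then have "kappa_tilde M N A (- a) * p = l" using p by simp
  with l(2) show ?thesis by (simp add: v_def[abs_def])
qed

section \<open>The moment statements in terms of \<open>u\<close>\<close>

lemma moment_iff_u_tendsto_0:
  "(\<integral>\<^sup>+ z. ennreal (l1norm z powr (- a)) \<partial>\<mu>) < \<infinity> \<longleftrightarrow> (\<lambda>n. enn2real (u n)) \<longlonglongrightarrow> 0"
proof -
  \<comment> \<open>The two powers differ only at 0, a null set of \<open>\<mu>\<close>.\<close>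
  have "(\<integral>\<^sup>+ z. F z \<partial>\<mu>) = (\<integral>\<^sup>+ z. ennreal (l1norm z powr (- a)) \<partial>\<mu>)"
    by (rule nn_integral_cong_AE, use mu_nonzero in eventually_elim)
       (simp add: F_def npow_eq_powr l1norm_pos_iff)
  then show ?thesis
    using moment_if_u_tendsto_0 u_tendsto_0_if_moment by auto
qed

lemma u_tendsto_0_if_p_0:
  assumes "p = 0" shows "(\<lambda>n. enn2real (u n)) \<longlonglongrightarrow> 0"
proof (rule tendsto_eventually)
  have ae: "AE \<omega> in M. N \<omega> \<noteq> 1"
    using assms by (subst (asm) M.prob_eq_0) auto
  have "T g x = 0" for g x
  proof -
    have "T g x = (\<integral>\<^sup>+ \<omega>. 0 \<partial>M)"
      unfolding T_def by (rule nn_integral_cong_AE) (use ae in eventually_elim, auto)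
    then show ?thesis by simp
  qed
  \<comment> \<open>Still \<open>u 0 = 1\<close>, so the sequence vanishes only from index 1
    on.\<close>
  then have "u (Suc n) = 0" for n by (simp add: u_def)
  then have u_0: "u n = 0" if "0 < n" for n using that by (cases n) auto
  show "eventually (\<lambda>n. enn2real (u n) = 0) sequentially"
    using eventually_gt_at_top[of "0::nat"] by eventually_elim (simp add: u_0)
qed

lemma lower_moment:
  assumes "(\<integral>\<^sup>+ z. ennreal (l1norm z powr (- a)) \<partial>\<mu>) < \<infinity>" "0 < b" "b < a"
  shows "(\<integral>\<^sup>+ z. ennreal (l1norm z powr (- b)) \<partial>\<mu>) < \<infinity>"
proof -
  have "r powr (- b) \<le> 1 + r powr (- a)" if "0 \<le> r" for r :: real
  proof -
    have "r = 0 \<or> 0 < r \<and> r \<le> 1 \<or> 1 \<le> r" using that by linarith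
    then consider "r = 0" | "0 < r" "r \<le> 1" | "1 \<le> r" by blast
    then show ?thesis
    proof cases
      case 2
      then have "r powr (- b) \<le> r powr (- a)" using assms by (intro powr_mono') auto
      then show ?thesis by simp
    next
      case 3
      then have "r powr (- b) \<le> r powr 0" using assms by (intro powr_mono) auto
      then have "r powr (- b) \<le> 1" using 3 by simp
      then show ?thesis by (rule add_increasing2[OF powr_ge_zero])
    qed simp
  qed
  then have "ennreal (l1norm z powr (- b)) \<le> 1 + ennreal (l1norm z powr (- a))" for z :: "real^'d"
    using ennreal_leI[of "l1norm z powr (- b)" "1 + l1norm z powr (- a)"] by simp
  then have "(\<integral>\<^sup>+ z. ennreal (l1norm z powr (- b)) \<partial>\<mu>) \<le> (\<integral>\<^sup>+ z. 1 + ennreal (l1norm z powr (- a)) \<partial>\<mu>)"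
    by (intro nn_integral_mono)
  also have "\<dots> = 1 + (\<integral>\<^sup>+ z. ennreal (l1norm z powr (- a)) \<partial>\<mu>)"
    by (subst nn_integral_add) (auto simp: mu.emeasure_space_1)
  finally show ?thesis using assms(1) by (simp add: le_less_trans)
qed

end

theorem theorem1p6:
  fixes M :: "'w measure" and N :: "'w \<Rightarrow> nat" and A :: "nat \<Rightarrow> 'w \<Rightarrow> 'd::finite mat"
    and \<mu> :: "(real ^ 'd) measure" and a :: real
  assumes prob: "prob_space M"
    and N_meas: "N \<in> measurable M (count_space UNIV)"
    and A_meas: "\<And>i. A i \<in> borel_measurable M"
    \<comment> \<open>(C1)\<close>
    and C1_N: "AE \<omega> in M. 1 \<le> N \<omega>"
    and C1_EN: "1 < (\<integral>\<^sup>+ \<omega>. ennreal (real (N \<omega>)) \<partial>M)" "(\<integral>\<^sup>+ \<omega>. ennreal (real (N \<omega>)) \<partial>M) < \<infinity>"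
    and C1_G: "AE \<omega> in M. \<forall>i. nonneg_mat (A i \<omega>)"
    and C1_supp: "AE \<omega> in M. \<forall>i. A i \<omega> \<noteq> 0 \<longleftrightarrow> i \<le> N \<omega>"
    \<comment> \<open>(C8)\<close>
    and C8: "\<exists>c>1. AE \<omega> in M.
               0 < Max {A 1 \<omega> $ i $ j | i j. True} \<and>
               Max {A 1 \<omega> $ i $ j | i j. True} \<le> c * Min {A 1 \<omega> $ i $ j | i j. True}"
    \<comment> \<open>Z (with law \<mu>) is an R_+^d-valued solution with P[Z = 0] = 0\<close>
    and mu_prob: "prob_space \<mu>"
    and mu_sets: "sets \<mu> = sets borel"
    and mu_nonneg: "AE z in \<mu>. \<forall>i. 0 \<le> z $ i"
    and mu_fix: "\<mu> = distr (M \<Otimes>\<^sub>M PiM UNIV (\<lambda>_::nat. \<mu>)) borel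
                       (\<lambda>(\<omega>, zs). \<Sum>i\<in>{1..N \<omega>}. A i \<omega> *v zs i)"
    and Z_nonzero: "emeasure \<mu> {0} = 0"
    \<comment> \<open>moment assumption on A_1\<close>
    and a_pos: "0 < a"
    and A1_mom: "(\<integral>\<^sup>+ \<omega>. ennreal (opnorm (A 1 \<omega>) powr (- a)) \<partial>M) < \<infinity>"
  shows "let pN1 = measure M {\<omega>\<in>space M. N \<omega> = 1};
             sa = ((\<integral>\<^sup>+ z. ennreal (l1norm z powr (- a)) \<partial>\<mu>) < \<infinity>);
             sb = (kappa_tilde M N A (- a) * pN1 < 1);
             sc = (\<forall>b\<in>{0<..<a}. (\<integral>\<^sup>+ z. ennreal (l1norm z powr (- b)) \<partial>\<mu>) < \<infinity>)
         in (pN1 = 0 \<longrightarrow> sc) \<and>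
            (0 < pN1 \<longrightarrow>
               (sa \<longrightarrow> sb) \<and> (sb \<longrightarrow> sc) \<and>
               ((\<exists>\<epsilon>>0. (\<integral>\<^sup>+ \<omega>. ennreal (opnorm (A 1 \<omega>) powr (- a - \<epsilon>)) \<partial>M) < \<infinity>)
                  \<longrightarrow> (sa \<longleftrightarrow> sb)))"
proof -
  interpret M: prob_space M by (rule prob)
  note N_meas [measurable] A_meas [measurable]
  obtain c where c: "1 < c" and C8': "AE \<omega> in M.
      0 < Max {A 1 \<omega> $ i $ j | i j. True} \<and>
      Max {A 1 \<omega> $ i $ j | i j. True} \<le> c * Min {A 1 \<omega> $ i $ j | i j. True}"
    using C8 by blast
  \<comment> \<open>Every entry lies between the minimum and the maximum, so the maximum is at most
    \<open>c\<close> times any entry; its positivity then passes to all entries.\<close>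
  have entries: "AE \<omega> in M. \<forall>i j k l. 0 < A 1 \<omega> $ i $ j \<and> A 1 \<omega> $ i $ j \<le> c * A 1 \<omega> $ k $ l"
    using C8'
  proof eventually_elim
    case (elim \<omega>)
    let ?E = "{A 1 \<omega> $ i $ j | i j. True}"
    have "?E = (\<lambda>(i, j). A 1 \<omega> $ i $ j) ` UNIV" by auto
    then have fin: "finite ?E" by (metis finite finite_imageI)
    have le: "A 1 \<omega> $ i $ j \<le> Max ?E" "Min ?E \<le> A 1 \<omega> $ i $ j" for i j
      using fin by (auto intro!: Max_ge Min_le)
    have bound: "Max ?E \<le> c * A 1 \<omega> $ k $ l" for k l
      using elim le(2)[of k l] c by (meson mult_left_mono less_imp_le order_trans zero_less_one)
    then have "0 < c * A 1 \<omega> $ k $ l" for k l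
      using elim less_le_trans by blast
    then have "0 < A 1 \<omega> $ k $ l" for k l
      using c by (simp add: zero_less_mult_iff)
    then show ?case
      using le(1) bound order_trans by blast
  qed
  \<comment> \<open>Positive entries make the norm positive, where \<open>npow\<close> and
    \<open>powr\<close> coincide.\<close>
  have moment: "(\<integral>\<^sup>+ \<omega>. npow a (opnorm (A 1 \<omega>)) \<partial>M) < \<infinity>"
  proof -
    have "(\<integral>\<^sup>+ \<omega>. npow a (opnorm (A 1 \<omega>)) \<partial>M) = (\<integral>\<^sup>+ \<omega>. ennreal (opnorm (A 1 \<omega>) powr (- a)) \<partial>M)"
    proof (rule nn_integral_cong_AE, use entries in eventually_elim)
      case (elim \<omega>)
      have "column undefined (A 1 \<omega>) \<noteq> 0"
        using elim by (metis column_def less_irrefl vec_lambda_beta zero_index)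
      then have "0 < opnorm (A 1 \<omega>)"
        using l1norm_column_le[of undefined "A 1 \<omega>"] by (metis l1norm_pos_iff less_le_trans)
      then show ?case by (rule npow_eq_powr)
    qed
    then show ?thesis using A1_mom by simp
  qed
  have branching: "\<not> (AE \<omega> in M. N \<omega> = 1)"
  proof
    assume ae: "AE \<omega> in M. N \<omega> = 1"
    have "(\<integral>\<^sup>+ \<omega>. ennreal (real (N \<omega>)) \<partial>M) = (\<integral>\<^sup>+ \<omega>. 1 \<partial>M)"
      by (rule nn_integral_cong_AE, use ae in eventually_elim) simp
    then show False
      using C1_EN(1) by (simp add: M.emeasure_space_1)
  qed
  have nonzero: "AE z in \<mu>. z \<noteq> 0"
    by (rule AE_I[of _ _ "{0}"]) (use Z_nonzero mu_sets in auto)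
  interpret smoothing M \<mu> N A a c
  proof (intro smoothing.intro smoothing_axioms.intro)
    show "AE \<omega> in M. 2 \<le> N \<omega> \<longrightarrow> A 2 \<omega> \<noteq> 0"
      using C1_supp by eventually_elim blast
  qed (fact | use c in simp)+
  have "(\<integral>\<^sup>+ z. ennreal (l1norm z powr (- b)) \<partial>\<mu>) < \<infinity>"
    if "(\<integral>\<^sup>+ z. ennreal (l1norm z powr (- a)) \<partial>\<mu>) < \<infinity>" "b \<in> {0<..<a}" for b
    using lower_moment[OF that(1)] that(2) by simp
  \<comment> \<open>Convergence of \<open>u\<close> to 0 is equivalent to (a) and, for positive
    \<open>pN1\<close>, to (b); it is automatic for \<open>pN1 = 0\<close>. Statement (c) follows
    from (a).\<close>
  then show ?thesis
    unfolding Let_def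
    using moment_iff_u_tendsto_0 u_tendsto_0_if_p_0 kappa_less_1_iff by blast
qed

end
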